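(* Let $K\subset\mathbb{R}^2$ be a convex body not reduced to a point, let $\gamma$ be a self-distancing curve from $K$, and let $w\in\gamma$, $w\notin K$. Then $$\gamma_w\subset\mathrm{cl}(\mathfrak{G}(K,w)),$$ where $\gamma_w=\{y\in\gamma:y\preceq w\}$.
   Context: CURVES. A self-distancing set is a bounded set $\sigma\subset\mathbb{R}^2$ linearly ordered by $\preceq$ such that $x_1\preceq x_2\preceq x_3$ in $\sigma$ implies $|x_2-x_1|\le|x_3-x_1|$. A steepest descent curve (SDC) is a closed connected self-distancing set not reduced to a point (such a set is known to be a rectifiable curve oriented by $\preceq$). For a convex body $K$, a self-distancing curve from $K$ ($SDC_K$) is an SDC $\gamma\subset\mathbb{R}^2\setminus\mathrm{relint}K$ which meets the relative boundary of $K$ and satisfies $|x-y|\le|x_1-y|$ for all $y\in K$ and all $x\preceq x_1$ in $\gamma$ (relint and relative boundary are taken in the affine hull of $K$). INVOLUTES. Let $K\subset\mathbb{R}^2$ be a convex body (nonempty compact convex set) not reduced to a point, $L=|\partial K|$ (if $K$ is a segment, $\partial K$ is regarded as the closed curve traversing it back and forth, $L$ being twice its length). $n_\vartheta=(\cos\vartheta,\sin\vartheta)$, $t_\vartheta=(-\sin\vartheta,\cos\vartheta)$, $h(\vartheta)=\max_{y\in K}\langle n_\vartheta,y\rangle$, $F(\vartheta)=\{x\in K:\langle n_\vartheta,x\rangle=h(\vartheta)\}$. $x_l,x_r:\mathbb{R}\to\partial K$ are the $L$-periodic arc-length parametrizations, counterclockwise and clockwise respectively. Fix $x_0=x_l(s_0)=x_r(s_0)\in\partial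 K$ and $\vartheta_0$ with $x_0\in F(\vartheta_0)$. $s_{l+}:\mathbb{R}\to\mathbb{R}$ is the nondecreasing right-continuous function with $s_{l+}(\vartheta+2\pi)=s_{l+}(\vartheta)+L$, such that $x_l$ maps $[s_{l+}(\vartheta-),s_{l+}(\vartheta)]$ one-to-one onto $F(\vartheta)$ for every $\vartheta$, and $s_0\in[s_{l+}(\vartheta_0-),s_{l+}(\vartheta_0)]$. $s_{r-}$ is the nonincreasing left-continuous function with $s_{r-}(\vartheta+2\pi)=s_{r-}(\vartheta)-L$, such that $x_r$ maps $[s_{r-}(\vartheta+),s_{r-}(\vartheta)]$ one-to-one onto $F(\vartheta)$, and $s_0\in[s_{r-}(\vartheta_0+),s_{r-}(\vartheta_0)]$. Put $\vartheta_0^+=\inf\{\vartheta:s_{l+}(\vartheta)>s_0\}$, $\vartheta_0^-=\sup\{\vartheta:s_{r-}(\vartheta)>s_0\}$. The left and right involutes of $\partial K$ starting at $x_0$ are $$i_{l,x_0}(\vartheta)=x_l(s_{l+}(\vartheta))-(s_{l+}(\vartheta)-s_0)t_\vartheta\ (\vartheta\ge\vartheta_0^+),\qquad i_{r,x_0}(\vartheta)=x_r(s_{r-}(\vartheta))+(s_{r-}(\vartheta)-s_0)t_\vartheta\ (\vartheta\le\vartheta_0^-).$$ $\mathfrak{G}$-FENCE. For $z\notin K$ there is exactly one left involute of $\partial K$, starting at some $\xi_l\in\partial K$, passing through $z$, and exactly one right involute, starting at some $\xi_r\in\partial K$, passing through $z$. Write $z=i_{l,\xi_l}(\vartheta_l)=i_{r,\xi_r}(\vartheta_r)$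 and let $\vartheta^+_{\xi_l}$, $\vartheta^-_{\xi_r}$ be the initial parameters of these involutes (the numbers $\vartheta_0^\pm$ above for the starting points $\xi_l,\xi_r$). Put $$\mathfrak{G}_l(K,z)=\{tx_l(s_{l+}(\vartheta))+(1-t)i_{l,\xi_l}(\vartheta):0<t<1,\ \vartheta^+_{\xi_l}<\vartheta<\vartheta_l\}\setminus K,$$ $$\mathfrak{G}_r(K,z)=\{tx_r(s_{r-}(\vartheta))+(1-t)i_{r,\xi_r}(\vartheta):0<t<1,\ \vartheta_r<\vartheta<\vartheta^-_{\xi_r}\}\setminus K,$$ $\mathfrak{G}(K,z)=\mathrm{Int}(\mathrm{cl}(\mathfrak{G}_l(K,z)\cup\mathfrak{G}_r(K,z)))\setminus K$ (the last removal of $K$ changes nothing when $K$ has interior points). *)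

theory Defs
  imports "HOL-Analysis.Analysis"
begin

section \<open>Self-distancing curves\<close>

text \<open>An order on a set is a relation \<open>r\<close>, with \<open>(x, y) \<in> r\<close> meaning that \<open>x\<close> precedes or
  equals \<open>y\<close>.\<close>

definition self_distancing :: "(real^2) set \<Rightarrow> (real^2) rel \<Rightarrow> bool" where
  "self_distancing \<sigma> r \<longleftrightarrow> bounded \<sigma> \<and> linear_order_on \<sigma> r \<and>
     (\<forall>x1\<in>\<sigma>. \<forall>x2\<in>\<sigma>. \<forall>x3\<in>\<sigma>. (x1, x2) \<in> r \<and> (x2, x3) \<in> r \<longrightarrow> norm (x2 - x1) \<le> norm (x3 - x1))"

definition SDC :: "(real^2) set \<Rightarrow> (real^2) rel \<Rightarrow> bool" where
  "SDC \<gamma> r \<longleftrightarrow> self_distancing \<gamma> r \<and> closed \<gamma> \<and> connected \<gamma> \<and> \<gamma> \<noteq> {} \<and> (\<nexists>a. \<gamma> = {a})"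

definition SDC_from :: "(real^2) set \<Rightarrow> (real^2) set \<Rightarrow> (real^2) rel \<Rightarrow> bool" where
  "SDC_from K \<gamma> r \<longleftrightarrow> SDC \<gamma> r \<and> \<gamma> \<subseteq> - rel_interior K \<and> \<gamma> \<inter> rel_frontier K \<noteq> {} \<and>
     (\<forall>y\<in>K. \<forall>x\<in>\<gamma>. \<forall>x1\<in>\<gamma>. (x, x1) \<in> r \<longrightarrow> norm (x - y) \<le> norm (x1 - y))"


section \<open>Convex bodies and parametrizations of their boundary\<close>

definition convex_body :: "(real^2) set \<Rightarrow> bool" where
  "convex_body K \<longleftrightarrow> K \<noteq> {} \<and> compact K \<and> convex K"

definition nvec :: "real \<Rightarrow> real^2" where
  "nvec \<theta> = vector [cos \<theta>, sin \<theta>]"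

definition tvec :: "real \<Rightarrow> real^2" where
  "tvec \<theta> = vector [- sin \<theta>, cos \<theta>]"

definition support_fun :: "(real^2) set \<Rightarrow> real \<Rightarrow> real" where
  "support_fun K \<theta> = (SUP y\<in>K. nvec \<theta> \<bullet> y)"

definition face :: "(real^2) set \<Rightarrow> real \<Rightarrow> (real^2) set" where
  "face K \<theta> = {x\<in>K. nvec \<theta> \<bullet> x = support_fun K \<theta>}"

definition curve_length :: "(real \<Rightarrow> real^2) \<Rightarrow> real \<Rightarrow> real \<Rightarrow> ennreal" where
  "curve_length x a b =
     (SUP ts\<in>{ts. sorted ts \<and> set ts \<subseteq> {a..b}}.
        \<Sum>i<length ts - 1. ennreal (dist (x (ts ! i)) (x (ts ! Suc i))))"

text \<open>An \<open>L\<close>-periodic arc-length parametrization of the boundary of \<open>K\<close>, running through the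
  boundary exactly once per period; hence \<open>L\<close> is the length of the boundary. If \<open>K\<close> has empty
  interior, i.e. is a segment, one period goes along \<open>K\<close> from one end to the other and back,
  so that \<open>L\<close> is twice the length of \<open>K\<close>.\<close>

definition boundary_param :: "(real^2) set \<Rightarrow> real \<Rightarrow> (real \<Rightarrow> real^2) \<Rightarrow> bool" where
  "boundary_param K L x \<longleftrightarrow> L > 0 \<and> (\<forall>s. x (s + L) = x s) \<and>
     (\<forall>a b. a \<le> b \<longrightarrow> curve_length x a b = ennreal (b - a)) \<and>
     (if interior K \<noteq> {} then bij_betw x {0..<L} (frontier K)
      else \<exists>c. bij_betw x {c..c + L/2} K \<and> bij_betw x {c + L/2..c + L} K)"

definition det2 :: "real^2 \<Rightarrow> real^2 \<Rightarrow> real" where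
  "det2 u v = u$1 * v$2 - u$2 * v$1"

text \<open>Orientation of an \<open>L\<close>-periodic parametrization of a convex curve: any three points met
  successively within one period form a (possibly degenerate) triangle of the given orientation.
  For a segment both conditions hold, since both orientations describe the same closed curve.\<close>

definition counterclockwise :: "real \<Rightarrow> (real \<Rightarrow> real^2) \<Rightarrow> bool" where
  "counterclockwise L x \<longleftrightarrow>
     (\<forall>s1 s2 s3. s1 < s2 \<and> s2 < s3 \<and> s3 < s1 + L \<longrightarrow> det2 (x s2 - x s1) (x s3 - x s1) \<ge> 0)"

definition clockwise :: "real \<Rightarrow> (real \<Rightarrow> real^2) \<Rightarrow> bool" where
  "clockwise L x \<longleftrightarrow>
     (\<forall>s1 s2 s3. s1 < s2 \<and> s2 < s3 \<and> s3 < s1 + L \<longrightarrow> det2 (x s2 - x s1) (x s3 - x s1) \<le> 0)"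


section \<open>Involutes\<close>

text \<open>\<open>left_system K L xl sl x0 s0 \<theta>0\<close>: the functions \<open>xl\<close> and \<open>sl\<close> (\<open>s\<close> with index \<open>l+\<close>)
  belonging to the starting point \<open>x0 = xl s0\<close> in the face of direction \<open>\<theta>0\<close>.
  These conditions determine \<open>sl\<close> once \<open>xl\<close>, \<open>s0\<close>, \<open>\<theta>0\<close> are given.\<close>

definition left_system ::
  "(real^2) set \<Rightarrow> real \<Rightarrow> (real \<Rightarrow> real^2) \<Rightarrow> (real \<Rightarrow> real) \<Rightarrow> real^2 \<Rightarrow> real \<Rightarrow> real \<Rightarrow> bool" where
  "left_system K L xl sl x0 s0 \<theta>0 \<longleftrightarrow>
     boundary_param K L xl \<and> counterclockwise L xl \<and>
     mono sl \<and> (\<forall>\<theta>. continuous (at_right \<theta>) sl) \<and> (\<forall>\<theta>. sl (\<theta> + 2 * pi) = sl \<theta> + L) \<and>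
     (\<forall>\<theta>. bij_betw xl {Lim (at_left \<theta>) sl..sl \<theta>} (face K \<theta>)) \<and>
     x0 = xl s0 \<and> x0 \<in> face K \<theta>0 \<and> s0 \<in> {Lim (at_left \<theta>0) sl..sl \<theta>0}"

definition right_system ::
  "(real^2) set \<Rightarrow> real \<Rightarrow> (real \<Rightarrow> real^2) \<Rightarrow> (real \<Rightarrow> real) \<Rightarrow> real^2 \<Rightarrow> real \<Rightarrow> real \<Rightarrow> bool" where
  "right_system K L xr sr x0 s0 \<theta>0 \<longleftrightarrow>
     boundary_param K L xr \<and> clockwise L xr \<and>
     antimono sr \<and> (\<forall>\<theta>. continuous (at_left \<theta>) sr) \<and> (\<forall>\<theta>. sr (\<theta> + 2 * pi) = sr \<theta> - L) \<and>
     (\<forall>\<theta>. bij_betw xr {Lim (at_right \<theta>) sr..sr \<theta>} (face K \<theta>)) \<and>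
     x0 = xr s0 \<and> x0 \<in> face K \<theta>0 \<and> s0 \<in> {Lim (at_right \<theta>0) sr..sr \<theta>0}"

definition left_start :: "(real \<Rightarrow> real) \<Rightarrow> real \<Rightarrow> real" where
  "left_start sl s0 = Inf {\<theta>. sl \<theta> > s0}"

definition right_start :: "(real \<Rightarrow> real) \<Rightarrow> real \<Rightarrow> real" where
  "right_start sr s0 = Sup {\<theta>. sr \<theta> > s0}"

text \<open>The left involute is the restriction of \<open>left_involute xl sl s0\<close> to \<open>\<theta> \<ge> left_start sl s0\<close>,
  the right one that of \<open>right_involute xr sr s0\<close> to \<open>\<theta> \<le> right_start sr s0\<close>.\<close>

definition left_involute ::
  "(real \<Rightarrow> real^2) \<Rightarrow> (real \<Rightarrow> real) \<Rightarrow> real \<Rightarrow> real \<Rightarrow> real^2" where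
  "left_involute xl sl s0 \<theta> = xl (sl \<theta>) - (sl \<theta> - s0) *\<^sub>R tvec \<theta>"

definition right_involute ::
  "(real \<Rightarrow> real^2) \<Rightarrow> (real \<Rightarrow> real) \<Rightarrow> real \<Rightarrow> real \<Rightarrow> real^2" where
  "right_involute xr sr s0 \<theta> = xr (sr \<theta>) + (sr \<theta> - s0) *\<^sub>R tvec \<theta>"


section \<open>The fence\<close>

text \<open>The fence of \<open>K\<close> and \<open>z\<close> is expressed through the data of the two involutes passing through
  \<open>z\<close>: \<open>z = left_involute xl sl \<sigma>l \<theta>l = right_involute xr sr \<sigma>r \<theta>r\<close>, where \<open>\<sigma>l\<close> and \<open>\<sigma>r\<close> are the
  arc-length parameters of the starting points \<open>xl \<sigma>l\<close> and \<open>xr \<sigma>r\<close>.\<close>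

definition left_fence ::
  "(real^2) set \<Rightarrow> (real \<Rightarrow> real^2) \<Rightarrow> (real \<Rightarrow> real) \<Rightarrow> real \<Rightarrow> real \<Rightarrow> (real^2) set" where
  "left_fence K xl sl \<sigma>l \<theta>l =
     {t *\<^sub>R xl (sl \<theta>) + (1 - t) *\<^sub>R left_involute xl sl \<sigma>l \<theta> | t \<theta>.
        0 < t \<and> t < 1 \<and> left_start sl \<sigma>l < \<theta> \<and> \<theta> < \<theta>l} - K"

definition right_fence ::
  "(real^2) set \<Rightarrow> (real \<Rightarrow> real^2) \<Rightarrow> (real \<Rightarrow> real) \<Rightarrow> real \<Rightarrow> real \<Rightarrow> (real^2) set" where
  "right_fence K xr sr \<sigma>r \<theta>r =
     {t *\<^sub>R xr (sr \<theta>) + (1 - t) *\<^sub>R right_involute xr sr \<sigma>r \<theta> | t \<theta>.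
        0 < t \<and> t < 1 \<and> \<theta>r < \<theta> \<and> \<theta> < right_start sr \<sigma>r} - K"

text \<open>\<open>is_fence K z G\<close>: \<open>G\<close> is the fence of \<open>K\<close> and \<open>z\<close>. For \<open>z \<notin> K\<close> the two involutes through
  \<open>z\<close> exist and are unique, and another choice of the parametrizations or of
  the base points \<open>(\<sigma>, \<theta>0)\<close> only shifts the parameters, so there is exactly one such \<open>G\<close>.\<close>

definition is_fence :: "(real^2) set \<Rightarrow> real^2 \<Rightarrow> (real^2) set \<Rightarrow> bool" where
  "is_fence K z G \<longleftrightarrow>
     (\<exists>L xl sl \<xi>l \<sigma>l \<theta>0l \<theta>l xr sr \<xi>r \<sigma>r \<theta>0r \<theta>r.
        left_system K L xl sl \<xi>l \<sigma>l \<theta>0l \<and> left_start sl \<sigma>l \<le> \<theta>l \<and>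
        z = left_involute xl sl \<sigma>l \<theta>l \<and>
        right_system K L xr sr \<xi>r \<sigma>r \<theta>0r \<and> \<theta>r \<le> right_start sr \<sigma>r \<and>
        z = right_involute xr sr \<sigma>r \<theta>r \<and>
        G = interior (closure (left_fence K xl sl \<sigma>l \<theta>l \<union> right_fence K xr sr \<sigma>r \<theta>r)) - K)"

end

theory Submission
  imports Defs
begin

text \<open>
  Every point \<open>x\<close> outside \<open>K\<close> has two tangents to \<open>K\<close>. Take the left one, touching the boundary at
  the arc-length parameter \<open>s\<close>, and wind its segment from \<open>x\<close> to the contact point back onto the
  boundary, like a string. The end of the string comes to lie at the parameter
  \<open>u x = s - dist x (xl s)\<close>, which is where the left involute through \<open>x\<close> starts. So the left fence
  of \<open>w\<close> consists, up to its boundary, of the points \<open>x\<close> with \<open>u w \<le> u x\<close> whose left tangent has not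
  turned beyond that of \<open>w\<close>; the right fence is described by the same data with right and left exchanged.

  The gradient of \<open>u\<close> is the unit vector from \<open>x\<close> to its contact point. A curve along which the
  distances to all points of \<open>K\<close> increase moves away from that point, so \<open>u\<close> decreases along it. No
  differentiability of the curve is available, and \<open>unwound_decreasing\<close> proves this by finite
  differences. If the tangent direction turns back, it is a triangle inequality. If the direction
  turns forward by a small angle \<open>d\<close>, the arc between the two contact points advances along the
  first tangent by at least \<open>cos d\<close> times its length (\<open>contact_progress\<close>), so \<open>u\<close> grows by at most
  \<open>1 - cos d\<close> times the length of this arc. The curve meets every intermediate tangent line, so a
  large turn can be cut into \<open>n\<close> equal ones, and the sum of the errors tends to \<open>0\<close>.

  Tangent directions are angles up to full turns, and a curve may wind around \<open>K\<close>; hence they have to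
  be followed continuously. Near a point outside \<open>K\<close> one direction \<open>\<phi>\<close> separates all points from \<open>K\<close>,
  and then the left and right tangent directions are determined in \<open>(\<phi>, \<phi> + pi)\<close> and
  \<open>(\<phi> - pi, \<phi>)\<close>. The inequalities for the two tangents pass from \<open>w\<close> backward along such pieces of
  the curve, and by connectedness along all of it (\<open>backward_induct\<close>).

  It remains to exclude that the left tangent at a point \<open>x\<close> before \<open>w\<close> has turned beyond that of \<open>w\<close>
  while the right tangent has done so too, in the opposite sense. Then \<open>x\<close> would be in the wedge
  behind \<open>w\<close>, and some point of \<open>K\<close> would be farther from \<open>x\<close> than from \<open>w\<close>, although the
  distances increase along the curve (\<open>no_strictly_wider_tangents\<close>). So \<open>x\<close> belongs to the closure of one of the two fences. Finally
  these fences are open (\<open>open_left_fence\<close>), so that the passage to the interior of the closure loses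
  nothing, and a point of the curve on the boundary of \<open>K\<close> is a limit of later points of the curve.

  Right involutes are left involutes of the reflected body, so everything is proved for left ones.
\<close>


section \<open>The rotating frame\<close>

lemma inner_real2: "(u::real^2) \<bullet> v = u$1 * v$1 + u$2 * v$2"
  by (simp add: inner_vec_def sum_2)

lemma vec2_eqI: "(u::real^2)$1 = v$1 \<Longrightarrow> u$2 = v$2 \<Longrightarrow> u = v"
  by (simp add: vec_eq_iff forall_2)

lemma frame_nth [simp]:
  "nvec a $ 1 = cos a" "nvec a $ 2 = sin a" "tvec a $ 1 = - sin a" "tvec a $ 2 = cos a"
  by (simp_all add: nvec_def tvec_def)

lemma nvec_inner_tvec: "nvec a \<bullet> tvec b = sin (a - b)"
  by (simp add: inner_real2 sin_diff algebra_simps)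

lemma tvec_inner_tvec: "tvec a \<bullet> tvec b = cos (a - b)"
  by (simp add: inner_real2 cos_diff algebra_simps)

lemma nvec_inner_nvec: "nvec a \<bullet> nvec b = cos (a - b)"
  by (simp add: inner_real2 cos_diff algebra_simps)

lemma norm_nvec [simp]: "norm (nvec a) = 1"
  by (simp add: norm_eq_sqrt_inner nvec_inner_nvec)

lemma norm_tvec [simp]: "norm (tvec a) = 1"
  by (simp add: norm_eq_sqrt_inner tvec_inner_tvec)

lemma nvec_inner_le_norm: "nvec a \<bullet> v \<le> norm v"
  using norm_cauchy_schwarz[of "nvec a" v] by simp

lemma tvec_inner_le_norm: "tvec a \<bullet> v \<le> norm v"
  using norm_cauchy_schwarz[of "tvec a" v] by simp

lemma frame_rotate: "nvec b \<bullet> v = cos (b - a) * (nvec a \<bullet> v) + sin (b - a) * (tvec a \<bullet> v)"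
proof -
  have "cos b = cos ((b - a) + a)" "sin b = sin ((b - a) + a)" by simp_all
  then have c: "cos b = cos (b - a) * cos a - sin (b - a) * sin a"
    and s: "sin b = sin (b - a) * cos a + cos (b - a) * sin a"
    by (simp_all only: cos_add sin_add)
  show ?thesis
    unfolding inner_real2 frame_nth c s by (simp add: algebra_simps)
qed

lemma tvec_rotate: "tvec b \<bullet> v = cos (b - a) * (tvec a \<bullet> v) - sin (b - a) * (nvec a \<bullet> v)"
proof -
  have "nvec (\<theta> + pi / 2) = tvec \<theta>" for \<theta> by (rule vec2_eqI) (simp_all add: cos_add sin_add)
  moreover have "tvec (\<theta> + pi / 2) = - nvec \<theta>" for \<theta> by (rule vec2_eqI) (simp_all add: cos_add sin_add)
  ultimately show ?thesis using frame_rotate[of "b + pi / 2" v "a + pi / 2"] by simp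
qed

lemma frame_decompose: "v = (nvec a \<bullet> v) *\<^sub>R nvec a + (tvec a \<bullet> v) *\<^sub>R tvec a"
proof -
  have cs: "cos a * cos a + sin a * sin a = 1"
    using sin_cos_squared_add[of a] by (simp add: power2_eq_square)
  have "cos a * (cos a * v $ i) + sin a * (sin a * v $ i) = (cos a * cos a + sin a * sin a) * v $ i" for i
    by (simp only: distrib_right mult.assoc)
  then have "cos a * (cos a * v $ i) + sin a * (sin a * v $ i) = v $ i" for i
    by (simp only: cs mult_1)
  then show ?thesis
    by (intro vec2_eqI) (simp_all add: inner_real2 algebra_simps)
qed

lemma nvec_add_2pi_int: "nvec (a + 2 * pi * of_int k) = nvec a"
  by (rule vec2_eqI) (simp_all add: cos_add sin_add)

lemma nvec_add_pi: "nvec (a + pi) = - nvec a"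
  by (rule vec2_eqI) simp_all

lemma nvec_polar: "\<exists>\<phi>. v = norm v *\<^sub>R nvec \<phi>"
proof (cases "v = 0")
  case False
  have "(v$1 / norm v)\<^sup>2 + (v$2 / norm v)\<^sup>2 = (v \<bullet> v) / (norm v)\<^sup>2"
    by (simp add: inner_real2 power2_eq_square add_divide_distrib)
  also have "\<dots> = 1" using False by (simp add: power2_norm_eq_inner)
  finally obtain \<phi> where "v$1 / norm v = cos \<phi>" "v$2 / norm v = sin \<phi>"
    using sincos_total_2pi by metis
  then have "v = norm v *\<^sub>R nvec \<phi>" using False
    by (intro vec2_eqI) (auto simp: field_simps)
  then show ?thesis by blast
qed simp

lemma angle_shift_near: "\<exists>k::int. \<bar>(a::real) + 2 * pi * of_int k - b\<bar> \<le> pi"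
proof -
  let ?k = "round ((b - a) / (2 * pi))"
  have "\<bar>of_int ?k - (b - a) / (2 * pi)\<bar> \<le> 1 / 2" by (rule of_int_round_abs_le)
  then have "2 * pi * \<bar>of_int ?k - (b - a) / (2 * pi)\<bar> \<le> 2 * pi * (1 / 2)"
    by (intro mult_left_mono) auto
  then have "\<bar>2 * pi * (of_int ?k - (b - a) / (2 * pi))\<bar> \<le> pi" by (simp add: abs_mult)
  also have "2 * pi * (of_int ?k - (b - a) / (2 * pi)) = a + 2 * pi * of_int ?k - b"
    using nonzero_mult_div_cancel_left[of "2 * pi" "b - a"]
    by (simp only: right_diff_distrib times_divide_eq_right) simp
  finally show ?thesis by blast
qed

lemma tendsto_nvec [tendsto_intros]: "(f \<longlongrightarrow> a) F \<Longrightarrow> ((\<lambda>x. nvec (f x)) \<longlongrightarrow> nvec a) F"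
proof (rule vec_tendstoI)
  fix i :: 2
  assume "(f \<longlongrightarrow> a) F"
  then have "((\<lambda>x. cos (f x)) \<longlongrightarrow> cos a) F" "((\<lambda>x. sin (f x)) \<longlongrightarrow> sin a) F"
    by (auto intro: isCont_tendsto_compose[OF isCont_cos] isCont_tendsto_compose[OF isCont_sin])
  then show "((\<lambda>x. nvec (f x) $ i) \<longlongrightarrow> nvec a $ i) F"
    using exhaust_2[of i] by (elim disjE) (simp_all add: tendsto_minus)
qed

lemma tendsto_tvec [tendsto_intros]: "(f \<longlongrightarrow> a) F \<Longrightarrow> ((\<lambda>x. tvec (f x)) \<longlongrightarrow> tvec a) F"
proof (rule vec_tendstoI)
  fix i :: 2
  assume "(f \<longlongrightarrow> a) F"
  then have "((\<lambda>x. cos (f x)) \<longlongrightarrow> cos a) F" "((\<lambda>x. sin (f x)) \<longlongrightarrow> sin a) F"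
    by (auto intro: isCont_tendsto_compose[OF isCont_cos] isCont_tendsto_compose[OF isCont_sin])
  then show "((\<lambda>x. tvec (f x) $ i) \<longlongrightarrow> tvec a $ i) F"
    using exhaust_2[of i] by (elim disjE) (simp_all add: tendsto_minus)
qed

lemma continuous_nvec [continuous_intros]:
  "continuous_on S f \<Longrightarrow> continuous_on S (\<lambda>x. nvec (f x))"
  by (auto simp: continuous_on_def intro: tendsto_intros)


section \<open>Separating directions and tangent directions\<close>

lemma convex_body_bdd: "convex_body K \<Longrightarrow> bdd_above ((\<lambda>y. nvec \<theta> \<bullet> y) ` K)"
  unfolding convex_body_def
  by (intro bounded_imp_bdd_above compact_imp_bounded compact_continuous_image continuous_intros) auto

lemma support_fun_ge: "convex_body K \<Longrightarrow> y \<in> K \<Longrightarrow> nvec \<theta> \<bullet> y \<le> support_fun K \<theta>"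
  unfolding support_fun_def by (rule cSUP_upper) (auto intro: convex_body_bdd)

lemma support_fun_attained:
  assumes "convex_body K" obtains y where "y \<in> face K \<theta>"
proof -
  have "\<exists>y\<in>K. \<forall>z\<in>K. nvec \<theta> \<bullet> z \<le> nvec \<theta> \<bullet> y"
    using assms unfolding convex_body_def
    by (intro continuous_attains_sup continuous_intros) auto
  then obtain y where y: "y \<in> K" "\<And>z. z \<in> K \<Longrightarrow> nvec \<theta> \<bullet> z \<le> nvec \<theta> \<bullet> y" by blast
  then have "support_fun K \<theta> \<le> nvec \<theta> \<bullet> y"
    unfolding support_fun_def by (intro cSUP_least) auto
  with y support_fun_ge[OF assms, of y \<theta>] that[of y] show ?thesis
    by (auto simp: face_def)
qed

lemma faceD: "y \<in> face K \<theta> \<Longrightarrow> y \<in> K" "y \<in> face K \<theta> \<Longrightarrow> nvec \<theta> \<bullet> y = support_fun K \<theta>"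
  by (auto simp: face_def)

lemma support_fun_add_2pi_int: "support_fun K (\<theta> + 2 * pi * of_int k) = support_fun K \<theta>"
  by (simp only: support_fun_def nvec_add_2pi_int)

lemma continuous_support_fun:
  assumes "convex_body K" shows "continuous_on S (support_fun K)"
proof -
  from assms obtain B where B: "\<And>y. y \<in> K \<Longrightarrow> norm y \<le> B"
    unfolding convex_body_def by (metis bounded_iff compact_imp_bounded)
  have le: "support_fun K b - support_fun K a \<le> B * norm (nvec b - nvec a)" for a b
  proof -
    obtain y where y: "y \<in> face K b" using support_fun_attained[OF assms] .
    have "support_fun K b - support_fun K a \<le> nvec b \<bullet> y - nvec a \<bullet> y"
      using faceD[OF y] support_fun_ge[OF assms, of y a] by simp
    also have "\<dots> = (nvec b - nvec a) \<bullet> y" by (simp add: inner_diff_left)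
    also have "\<dots> \<le> norm (nvec b - nvec a) * norm y" by (rule norm_cauchy_schwarz)
    also have "\<dots> \<le> norm (nvec b - nvec a) * B"
      by (intro mult_left_mono B faceD[OF y]) auto
    finally show ?thesis by (simp add: mult.commute)
  qed
  have bound: "dist (support_fun K b) (support_fun K a) \<le> B * norm (nvec b - nvec a)" for a b
    using le[of b a] le[of a b] by (simp add: dist_real_def abs_le_iff norm_minus_commute)
  have "(support_fun K \<longlongrightarrow> support_fun K a) (at a within S)" for a
  proof (rule tendsto_dist_iff[THEN iffD2], rule tendsto_sandwich[OF _ _ tendsto_const])
    show "\<forall>\<^sub>F x in at a within S. 0 \<le> dist (support_fun K x) (support_fun K a)" by simp
    show "\<forall>\<^sub>F x in at a within S. dist (support_fun K x) (support_fun K a) \<le> B * norm (nvec x - nvec a)"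
      using bound by simp
    show "((\<lambda>x. B * norm (nvec x - nvec a)) \<longlongrightarrow> 0) (at a within S)"
      by (rule tendsto_eq_intros | simp)+
  qed
  then show ?thesis by (simp add: continuous_on_def)
qed

definition separates :: "(real^2) set \<Rightarrow> real^2 \<Rightarrow> real \<Rightarrow> bool" where
  "separates K x \<phi> \<longleftrightarrow> (\<forall>y\<in>K. nvec \<phi> \<bullet> y < nvec \<phi> \<bullet> x)"

lemma separates_iff_support_fun:
  assumes "convex_body K" shows "separates K x \<phi> \<longleftrightarrow> support_fun K \<phi> < nvec \<phi> \<bullet> x"
proof -
  obtain y where "y \<in> face K \<phi>" using support_fun_attained[OF assms] .
  then show ?thesis unfolding separates_def
    using faceD support_fun_ge[OF assms] by (metis le_less_trans)
qed

lemma separates_notin: "separates K x \<phi> \<Longrightarrow> x \<notin> K"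
  by (auto simp: separates_def)

lemma separates_2pi_int: "separates K x (\<phi> + 2 * pi * of_int k) \<longleftrightarrow> separates K x \<phi>"
  by (simp only: separates_def nvec_add_2pi_int)

lemma separates_not_opposite:
  assumes "convex_body K" "separates K x \<phi>" shows "\<not> separates K x (\<phi> + pi)"
  using assms by (fastforce simp: separates_def nvec_add_pi convex_body_def)

lemma separates_nearby:
  assumes "convex_body K" "x \<notin> K"
  obtains \<phi> e where "e > 0" "\<And>z. dist x z < e \<Longrightarrow> separates K z \<phi>"
proof -
  have "convex K" "closed K" using assms by (auto simp: convex_body_def compact_imp_closed)
  then obtain a b where ab: "a \<bullet> x < b" "\<And>y. y \<in> K \<Longrightarrow> b < a \<bullet> y"
    using separating_hyperplane_closed_point[of K x] assms by blast
  obtain y where y: "y \<in> K" using assms by (auto simp: convex_body_def)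
  then have a0: "norm a > 0" using ab(1) ab(2)[OF y] by auto
  obtain \<phi> where "- a = norm (- a) *\<^sub>R nvec \<phi>" using nvec_polar by blast
  then have a: "a = - (norm a *\<^sub>R nvec \<phi>)" by (metis minus_equation_iff norm_minus_cancel)
  define e where "e = (b - a \<bullet> x) / norm a"
  have "e > 0" using ab(1) a0 by (simp add: e_def)
  moreover have "separates K z \<phi>" if "dist x z < e" for z
    unfolding separates_def
  proof
    fix y assume y: "y \<in> K"
    have 1: "a \<bullet> v = - norm a * (nvec \<phi> \<bullet> v)" for v by (subst a) simp
    have "nvec \<phi> \<bullet> (x - z) \<le> norm (x - z)" by (rule nvec_inner_le_norm)
    then have "nvec \<phi> \<bullet> (x - z) < e" using that by (simp add: dist_norm)
    then have "norm a * (nvec \<phi> \<bullet> (x - z)) < b - a \<bullet> x"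
      using a0 by (simp add: e_def field_simps)
    then have "norm a * (nvec \<phi> \<bullet> y) < norm a * (nvec \<phi> \<bullet> z)"
      using ab(2)[OF y] unfolding 1 by (simp add: inner_diff_right algebra_simps)
    then show "nvec \<phi> \<bullet> y < nvec \<phi> \<bullet> z" using a0 by simp
  qed
  ultimately show ?thesis using that by blast
qed

text \<open>The separating direction \<open>\<phi>\<close> serves to fix one of the angles \<open>\<theta> + 2 * pi * k\<close> of the tangent.
  The separating directions near \<open>\<phi>\<close> form an interval, and \<open>\<theta>\<close> is its upper end.\<close>

definition left_tangent :: "(real^2) set \<Rightarrow> real^2 \<Rightarrow> real \<Rightarrow> real \<Rightarrow> bool" where
  "left_tangent K x \<phi> \<theta> \<longleftrightarrow> \<phi> < \<theta> \<and> \<theta> < \<phi> + pi \<and> nvec \<theta> \<bullet> x = support_fun K \<theta>"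

text \<open>For a point \<open>y\<close> of the body, \<open>nvec \<psi> \<bullet> (y - x)\<close> is a sine curve in \<open>\<psi>\<close>. One that is negative at
  \<open>\<phi>\<close> and not negative at \<open>\<theta>\<close> is positive after \<open>\<theta>\<close> and up to \<open>\<phi> + pi\<close>.\<close>

lemma not_separates_turn:
  assumes K: "convex_body K" and sep: "separates K x \<phi>"
    and th: "\<phi> < \<theta>" "\<theta> < \<theta>'" "\<theta>' \<le> \<phi> + pi"
    and le: "nvec \<theta> \<bullet> x \<le> support_fun K \<theta>"
  shows "nvec \<theta>' \<bullet> x < support_fun K \<theta>'"
proof -
  obtain y where y: "y \<in> face K \<theta>" using support_fun_attained[OF K] .
  let ?d = "y - x"
  have 1: "nvec \<theta> \<bullet> ?d \<ge> 0" using le faceD[OF y] by (simp add: inner_diff_right)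
  have 2: "nvec \<phi> \<bullet> ?d < 0" using sep faceD[OF y] by (simp add: separates_def inner_diff_right)
  have id: "sin (\<theta> - \<phi>) * (nvec \<theta>' \<bullet> ?d)
      = sin (\<theta>' - \<phi>) * (nvec \<theta> \<bullet> ?d) - sin (\<theta>' - \<theta>) * (nvec \<phi> \<bullet> ?d)"
  proof -
    define p q where pq: "p = \<phi> - \<theta>" "q = \<theta>' - \<theta>"
    define n t where nt: "n = nvec \<theta> \<bullet> ?d" "t = tvec \<theta> \<bullet> ?d"
    have e: "\<theta>' - \<phi> = q - p" "\<theta> - \<phi> = - p" by (simp_all add: pq)
    have 1: "nvec \<phi> \<bullet> ?d = cos p * n + sin p * t" "nvec \<theta>' \<bullet> ?d = cos q * n + sin q * t"
      unfolding pq nt by (rule frame_rotate)+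
    show ?thesis
      unfolding e 1 nt(1)[symmetric] pq(2)[symmetric] sin_minus sin_diff by (simp add: algebra_simps)
  qed
  have "sin (\<theta> - \<phi>) > 0" "sin (\<theta>' - \<theta>) > 0" "sin (\<theta>' - \<phi>) \<ge> 0"
    using th by (auto intro!: sin_gt_zero sin_ge_zero)
  then have "sin (\<theta>' - \<phi>) * (nvec \<theta> \<bullet> ?d) \<ge> 0" "sin (\<theta>' - \<theta>) * (nvec \<phi> \<bullet> ?d) < 0"
    using 1 2 by (simp_all add: mult_pos_neg)
  then have "sin (\<theta> - \<phi>) * (nvec \<theta>' \<bullet> ?d) > 0" unfolding id by linarith
  then have "nvec \<theta>' \<bullet> ?d > 0"
    using \<open>sin (\<theta> - \<phi>) > 0\<close> by (metis zero_less_mult_pos)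
  then show ?thesis using support_fun_ge[OF K faceD(1)[OF y], of \<theta>'] by (simp add: inner_diff_right)
qed

lemma left_tangent_exists:
  assumes K: "convex_body K" and sep: "separates K x \<phi>"
  obtains \<theta> where "left_tangent K x \<phi> \<theta>"
proof -
  let ?g = "\<lambda>\<theta>. support_fun K \<theta> - nvec \<theta> \<bullet> x"
  have g0: "?g \<phi> < 0" using sep K by (simp add: separates_iff_support_fun)
  obtain y where y: "y \<in> K" using K by (auto simp: convex_body_def)
  have "?g (\<phi> + pi) > 0"
    using sep y support_fun_ge[OF K y, of "\<phi> + pi"]
    by (fastforce simp: separates_def nvec_add_pi)
  moreover have "continuous_on {\<phi>..\<phi> + pi} ?g"
    by (intro continuous_intros continuous_support_fun K)
  ultimately obtain \<theta> where "\<theta> \<ge> \<phi>" "\<theta> \<le> \<phi> + pi" "?g \<theta> = 0"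
    using IVT'[of ?g \<phi> 0 "\<phi> + pi"] g0 by auto
  moreover from this have "\<theta> \<noteq> \<phi>" "\<theta> \<noteq> \<phi> + pi" using g0 \<open>?g (\<phi> + pi) > 0\<close> by auto
  ultimately show ?thesis using that[of \<theta>] by (auto simp: left_tangent_def)
qed

lemma separates_before_left_tangent:
  assumes K: "convex_body K" and sep: "separates K x \<phi>" and lt: "left_tangent K x \<phi> \<theta>"
    and "\<phi> \<le> \<psi>" "\<psi> < \<theta>"
  shows "separates K x \<psi>"
proof (rule ccontr)
  assume n: "\<not> separates K x \<psi>"
  then have "\<phi> < \<psi>" using sep assms by (cases "\<phi> = \<psi>") auto
  moreover have "nvec \<psi> \<bullet> x \<le> support_fun K \<psi>" using n K by (simp add: separates_iff_support_fun)
  ultimately show False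
    using not_separates_turn[OF K sep, of \<psi> \<theta>] assms by (auto simp: left_tangent_def)
qed

text \<open>The points of contact could lie on either side of \<open>x\<close> on the tangent line; that a direction
  before \<open>\<theta>\<close> separates decides for the side to which \<open>tvec \<theta>\<close> points.\<close>

lemma left_tangent_contact:
  assumes sep: "separates K x \<phi>" and lt: "left_tangent K x \<phi> \<theta>" and y: "y \<in> face K \<theta>"
  shows "tvec \<theta> \<bullet> (y - x) = dist x y" "dist x y > 0" "x = y - dist x y *\<^sub>R tvec \<theta>"
proof -
  have n0: "nvec \<theta> \<bullet> (y - x) = 0"
    using lt y by (simp add: left_tangent_def face_def inner_diff_right)
  have "sin (\<phi> - \<theta>) = - sin (\<theta> - \<phi>)" by (metis minus_diff_eq sin_minus)
  then have "nvec \<phi> \<bullet> (y - x) = - sin (\<theta> - \<phi>) * (tvec \<theta> \<bullet> (y - x))"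
    unfolding frame_rotate[of \<phi> "y - x" \<theta>] n0 by simp
  moreover have "nvec \<phi> \<bullet> (y - x) < 0"
    using sep y by (simp add: separates_def face_def inner_diff_right)
  moreover have "sin (\<theta> - \<phi>) > 0" using lt by (intro sin_gt_zero) (auto simp: left_tangent_def)
  ultimately have pos: "tvec \<theta> \<bullet> (y - x) > 0" by (simp add: zero_less_mult_iff)
  have "y - x = (nvec \<theta> \<bullet> (y - x)) *\<^sub>R nvec \<theta> + (tvec \<theta> \<bullet> (y - x)) *\<^sub>R tvec \<theta>"
    by (rule frame_decompose)
  also have "\<dots> = (tvec \<theta> \<bullet> (y - x)) *\<^sub>R tvec \<theta>" by (simp only: n0 scaleR_zero_left add_0)
  finally have d: "y - x = (tvec \<theta> \<bullet> (y - x)) *\<^sub>R tvec \<theta>" .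
  then have "norm (y - x) = \<bar>tvec \<theta> \<bullet> (y - x)\<bar> * norm (tvec \<theta>)" by (metis norm_scaleR)
  then show 1: "tvec \<theta> \<bullet> (y - x) = dist x y" using pos by (simp add: dist_norm norm_minus_commute)
  then show "dist x y > 0" using pos by simp
  have "x = y - (y - x)" by simp
  also note d
  finally show "x = y - dist x y *\<^sub>R tvec \<theta>" unfolding 1 .
qed

text \<open>Conversely, when a point of contact lies ahead, every separating direction is in
  \<open>(\<theta> - pi, \<theta>)\<close> up to full turns. The last hypothesis selects the turn.\<close>

lemma left_tangentI:
  assumes sep: "separates K x \<phi>" and y: "y \<in> face K \<theta>" and x: "x = y - \<rho> *\<^sub>R tvec \<theta>" "\<rho> \<ge> 0"
    and near: "\<bar>\<phi> - (\<theta> - pi / 2)\<bar> \<le> pi"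
  shows "left_tangent K x \<phi> \<theta>"
proof -
  have "nvec \<phi> \<bullet> y < nvec \<phi> \<bullet> x" using sep y by (simp add: separates_def face_def)
  then have "\<rho> * sin (\<phi> - \<theta>) < 0" by (simp add: x inner_diff_right nvec_inner_tvec)
  then have s: "sin (\<phi> - \<theta>) < 0" using x by (simp add: mult_less_0_iff)
  have "\<phi> < \<theta>"
    using s near sin_ge_zero[of "\<phi> - \<theta>"] by (cases "\<phi> \<ge> \<theta>") (auto simp: abs_le_iff)
  moreover have "\<theta> < \<phi> + pi"
  proof (rule ccontr)
    assume "\<not> ?thesis"
    then have "sin (\<phi> - \<theta> + 2 * pi) \<ge> 0"
      using near by (intro sin_ge_zero) (auto simp: abs_le_iff)
    then show False using s by simp
  qed
  moreover have "nvec \<theta> \<bullet> x = support_fun K \<theta>"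
    using y by (simp add: x face_def inner_diff_right nvec_inner_tvec)
  ultimately show ?thesis by (simp add: left_tangent_def)
qed

lemma left_tangent_shift:
  assumes K: "convex_body K" and "separates K x \<phi>" "separates K x \<phi>'" "\<bar>\<phi>' - \<phi>\<bar> < pi"
    and lt: "left_tangent K x \<phi> \<theta>"
  shows "left_tangent K x \<phi>' \<theta>"
proof -
  obtain y where y: "y \<in> face K \<theta>" using support_fun_attained[OF K] .
  note c = left_tangent_contact[OF assms(2) lt y]
  have "nvec \<phi>' \<bullet> y < nvec \<phi>' \<bullet> x" using assms(3) y by (simp add: separates_def face_def)
  also have "nvec \<phi>' \<bullet> x = nvec \<phi>' \<bullet> (y - dist x y *\<^sub>R tvec \<theta>)" using c(3) by simp
  finally have "dist x y * sin (\<phi>' - \<theta>) < 0" by (simp add: inner_diff_right nvec_inner_tvec)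
  then have s: "sin (\<phi>' - \<theta>) < 0" using c(2) by (simp add: mult_less_0_iff)
  have b: "\<phi> < \<theta>" "\<theta> < \<phi> + pi" using lt by (auto simp: left_tangent_def)
  have "\<phi>' < \<theta>"
    using s b assms(4) sin_ge_zero[of "\<phi>' - \<theta>"] by (cases "\<phi>' \<ge> \<theta>") (auto simp: abs_less_iff)
  moreover have "\<theta> < \<phi>' + pi"
  proof (rule ccontr)
    assume "\<not> ?thesis"
    then have "sin (\<phi>' - \<theta> + 2 * pi) \<ge> 0"
      using b assms(4) by (intro sin_ge_zero) (auto simp: abs_less_iff)
    then show False using s by simp
  qed
  ultimately show ?thesis using lt by (simp add: left_tangent_def)
qed


section \<open>Arcs of the boundary and the string unwound from it\<close>

lemma cos_diff_commute: "cos (x - y) = cos (y - x)" for x y :: real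
  by (metis cos_minus minus_diff_eq)

text \<open>The two sign conditions say that \<open>v\<close> is a nonnegative combination of \<open>tvec a\<close> and \<open>tvec b\<close>.\<close>

lemma cone_between_tangents:
  assumes "0 < b - a" "b - a < pi" "nvec a \<bullet> v \<le> 0" "nvec b \<bullet> v \<ge> 0"
    and c: "c \<le> cos (a - \<theta>)" "c \<le> cos (b - \<theta>)" "c \<ge> 0"
  shows "c * norm v \<le> tvec \<theta> \<bullet> v"
proof -
  let ?p = "nvec b \<bullet> v" and ?q = "- (nvec a \<bullet> v)"
  have s: "sin (b - a) > 0" using assms by (intro sin_gt_zero) auto
  have sab: "sin (a - b) = - sin (b - a)" by (metis minus_diff_eq sin_minus)
  have v: "sin (b - a) *\<^sub>R v = ?p *\<^sub>R tvec a + ?q *\<^sub>R tvec b"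
  proof -
    have v1: "sin (b - a) * v$1 = - ?p * sin a - ?q * sin b"
      unfolding inner_real2 frame_nth sin_diff by (simp add: algebra_simps)
    have "sin (b - a) * v$2 = ?p * cos a + ?q * cos b"
      unfolding inner_real2 frame_nth sin_diff by (simp add: algebra_simps)
    with v1 show ?thesis by (intro vec2_eqI) auto
  qed
  have "sin (b - a) * norm v = norm (sin (b - a) *\<^sub>R v)" using s by simp
  also have "\<dots> \<le> norm (?p *\<^sub>R tvec a) + norm (?q *\<^sub>R tvec b)"
    unfolding v by (rule norm_triangle_ineq)
  also have "\<dots> = ?p + ?q" using assms by simp
  finally have "c * (sin (b - a) * norm v) \<le> c * (?p + ?q)" using c by (intro mult_left_mono) auto
  also have "\<dots> \<le> cos (a - \<theta>) * ?p + cos (b - \<theta>) * ?q"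
    unfolding distrib_left using c assms by (intro add_mono mult_right_mono) auto
  also have "\<dots> = tvec \<theta> \<bullet> (sin (b - a) *\<^sub>R v)"
    unfolding v inner_add_right inner_scaleR_right tvec_inner_tvec
      cos_diff_commute[of \<theta> a] cos_diff_commute[of \<theta> b] by (simp only: mult.commute)
  finally have "sin (b - a) * (c * norm v) \<le> sin (b - a) * (tvec \<theta> \<bullet> v)" by (simp add: ac_simps)
  then show ?thesis using s by simp
qed

text \<open>The involutes considered in this locale start at an arbitrary parameter \<open>\<sigma>\<close>, not just at the base
  parameter \<open>s0\<close>.\<close>

locale left_unwinding =
  fixes K :: "(real^2) set" and L :: real and xl sl x0 s0 \<theta>0
  assumes body: "convex_body K" and sys: "left_system K L xl sl x0 s0 \<theta>0"
begin

definition sl_left :: "real \<Rightarrow> real" where "sl_left \<theta> = Lim (at_left \<theta>) sl"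

lemma sl_mono: "a \<le> b \<Longrightarrow> sl a \<le> sl b"
  using sys by (auto simp: left_system_def mono_def)

lemma sl_tendsto_right: "(sl \<longlongrightarrow> sl \<theta>) (at_right \<theta>)"
  using sys by (auto simp: left_system_def continuous_within)

lemma sl_tendsto_left: "(sl \<longlongrightarrow> sl_left \<theta>) (at_left \<theta>)"
proof -
  let ?l = "SUP y\<in>{..<\<theta>}. sl y"
  have bdd: "bdd_above (sl ` {..<\<theta>})" by (intro bdd_aboveI2[of _ _ "sl \<theta>"] sl_mono) auto
  have "(sl \<longlongrightarrow> ?l) (at_left \<theta>)"
  proof (rule order_tendstoI)
    fix a assume "a < ?l"
    then obtain y where y: "y < \<theta>" "a < sl y"
      using less_cSUP_iff[OF _ bdd, of a] lessThan_non_empty by auto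
    then have "a < sl x" if "x > y" for x using sl_mono[of y x] that by linarith
    then show "\<forall>\<^sub>F x in at_left \<theta>. a < sl x"
      using y by (auto simp: eventually_at_left[OF y(1)])
  next
    fix a assume "?l < a"
    then have "sl x < a" if "x < \<theta>" for x using cSUP_upper[OF _ bdd, of x] that by auto
    then show "\<forall>\<^sub>F x in at_left \<theta>. sl x < a"
      by (auto intro!: exI[of _ "\<theta> - 1"] simp: eventually_at_left[of "\<theta> - 1"])
  qed
  moreover from this have "sl_left \<theta> = ?l" unfolding sl_left_def
    by (intro tendsto_Lim) auto
  ultimately show ?thesis by simp
qed

lemma sl_left_ge: "y < \<theta> \<Longrightarrow> sl y \<le> sl_left \<theta>"
  by (rule tendsto_lowerbound[OF sl_tendsto_left])
    (auto simp: eventually_at_left intro!: exI[of _ y] sl_mono)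

lemma sl_left_le: "(\<And>y. y < \<theta> \<Longrightarrow> sl y \<le> a) \<Longrightarrow> sl_left \<theta> \<le> a"
  by (rule tendsto_upperbound[OF sl_tendsto_left])
    (auto simp: eventually_at_left[of "\<theta> - 1"] intro!: exI[of _ "\<theta> - 1"])

lemma sl_left_le_sl: "sl_left \<theta> \<le> sl \<theta>"
  by (intro sl_left_le sl_mono) auto

lemma face_param: "bij_betw xl {sl_left \<theta>..sl \<theta>} (face K \<theta>)"
  using sys by (auto simp: left_system_def sl_left_def)

lemma xl_in_face: "sl_left \<theta> \<le> a \<Longrightarrow> a \<le> sl \<theta> \<Longrightarrow> xl a \<in> face K \<theta>"
  using bij_betwE[OF face_param[of \<theta>]] by auto

lemma contact_in_face: "xl (sl \<theta>) \<in> face K \<theta>"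
  by (intro xl_in_face sl_left_le_sl order_refl)

lemma contact_in_body: "xl (sl \<theta>) \<in> K"
  by (rule faceD[OF contact_in_face])

lemma length_xl: "a \<le> b \<Longrightarrow> curve_length xl a b = ennreal (b - a)"
  using sys by (auto simp: left_system_def boundary_param_def)

lemma xl_lipschitz: "dist (xl a) (xl b) \<le> \<bar>a - b\<bar>"
proof -
  have *: "dist (xl a) (xl b) \<le> b - a" if "a \<le> b" for a b
  proof -
    have "(\<Sum>i<length [a, b] - 1. ennreal (dist (xl ([a, b] ! i)) (xl ([a, b] ! Suc i))))
        \<le> curve_length xl a b"
      unfolding curve_length_def by (rule SUP_upper) (use that in auto)
    then show ?thesis using that by (simp add: length_xl)
  qed
  show ?thesis using *[of a b] *[of b a] by (cases "a \<le> b") (auto simp: dist_commute)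
qed

lemma xl_tendsto: "(f \<longlongrightarrow> a) F \<Longrightarrow> ((\<lambda>x. xl (f x)) \<longlongrightarrow> xl a) F"
  by (erule metric_tendsto_imp_tendsto) (simp add: xl_lipschitz dist_real_def)

text \<open>The length of an arc is a supremum of sums of chords, so a lower bound for the progress of
  every chord in the direction \<open>e\<close> is inherited by the arc.\<close>

lemma arc_progress:
  assumes ab: "a \<le> b" and c: "c > 0"
    and chord: "\<And>p q. a \<le> p \<Longrightarrow> p \<le> q \<Longrightarrow> q \<le> b \<Longrightarrow> c * dist (xl p) (xl q) \<le> e \<bullet> (xl q - xl p)"
  shows "c * (b - a) \<le> e \<bullet> (xl b - xl a)"
proof -
  let ?M = "e \<bullet> (xl b - xl a)"
  have pos: "e \<bullet> (xl q - xl p) \<ge> 0" if "a \<le> p" "p \<le> q" "q \<le> b" for p q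
    using chord[OF that] c by (meson mult_nonneg_nonneg zero_le_dist less_imp_le order_trans)
  have "curve_length xl a b \<le> ennreal (?M / c)"
    unfolding curve_length_def
  proof (rule SUP_least)
    fix ts assume ts: "ts \<in> {ts. sorted ts \<and> set ts \<subseteq> {a..b}}"
    let ?n = "length ts - 1"
    have mem: "a \<le> ts ! i" "ts ! i \<le> b" if "i < length ts" for i
      using ts nth_mem[OF that] by auto
    have "(\<Sum>i<?n. c * dist (xl (ts ! i)) (xl (ts ! Suc i))) \<le> ?M"
    proof (cases "ts = []")
      case True then show ?thesis using pos[of a b] ab by simp
    next
      case False
      then have len: "0 < length ts" "?n < length ts" by auto
      have "(\<Sum>i<?n. c * dist (xl (ts ! i)) (xl (ts ! Suc i)))
          \<le> (\<Sum>i<?n. e \<bullet> xl (ts ! Suc i) - e \<bullet> xl (ts ! i))"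
        unfolding inner_diff_right[symmetric]
        by (intro sum_mono chord mem sorted_nth_mono) (use ts in auto)
      also have "\<dots> = e \<bullet> xl (ts ! ?n) - e \<bullet> xl (ts ! 0)" by (rule sum_lessThan_telescope)
      also have "\<dots> \<le> ?M"
        using pos[OF order_refl mem[OF len(1)]] pos[OF mem[OF len(2)] order_refl]
        by (simp add: inner_diff_right)
      finally show ?thesis .
    qed
    then have "(\<Sum>i<?n. dist (xl (ts ! i)) (xl (ts ! Suc i))) \<le> ?M / c"
      using c by (simp add: sum_distrib_left[symmetric] field_simps)
    then show "(\<Sum>i<?n. ennreal (dist (xl (ts ! i)) (xl (ts ! Suc i)))) \<le> ennreal (?M / c)"
      by (simp add: sum_ennreal ennreal_leI)
  qed
  then have "b - a \<le> ?M / c"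
    using ab c pos[of a b] by (simp add: length_xl)
  then show ?thesis using c by (simp add: field_simps)
qed

text \<open>Right-continuity orients the parametrization: just after \<open>\<theta>\<close> the contact points are ahead
  of the whole face, hence so is their limit.\<close>

lemma contact_is_top:
  assumes y: "y \<in> face K \<theta>" shows "tvec \<theta> \<bullet> y \<le> tvec \<theta> \<bullet> xl (sl \<theta>)"
proof (rule tendsto_lowerbound)
  show "((\<lambda>\<psi>. tvec \<theta> \<bullet> xl (sl \<psi>)) \<longlongrightarrow> tvec \<theta> \<bullet> xl (sl \<theta>)) (at_right \<theta>)"
    by (intro tendsto_intros xl_tendsto sl_tendsto_right)
  have "tvec \<theta> \<bullet> y \<le> tvec \<theta> \<bullet> xl (sl \<psi>)" if "\<theta> < \<psi>" "\<psi> < \<theta> + pi / 2" for \<psi>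
  proof -
    let ?v = "xl (sl \<psi>) - y"
    have "0 \<le> nvec \<psi> \<bullet> ?v"
      using faceD[OF contact_in_face[of \<psi>]] support_fun_ge[OF body faceD(1)[OF y], of \<psi>]
      by (simp add: inner_diff_right)
    also have "\<dots> = cos (\<psi> - \<theta>) * (nvec \<theta> \<bullet> ?v) + sin (\<psi> - \<theta>) * (tvec \<theta> \<bullet> ?v)"
      by (rule frame_rotate)
    also have "\<dots> \<le> sin (\<psi> - \<theta>) * (tvec \<theta> \<bullet> ?v)"
    proof -
      have "nvec \<theta> \<bullet> ?v \<le> 0"
        using faceD[OF y] support_fun_ge[OF body contact_in_body[of \<psi>], of \<theta>]
        by (simp add: inner_diff_right)
      moreover have "cos (\<psi> - \<theta>) \<ge> 0" using that by (intro cos_ge_zero) auto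
      ultimately show ?thesis by (simp add: mult_nonneg_nonpos)
    qed
    finally have "0 \<le> sin (\<psi> - \<theta>) * (tvec \<theta> \<bullet> ?v)" .
    moreover have "sin (\<psi> - \<theta>) > 0" using that pi_gt_zero by (intro sin_gt_zero) linarith+
    ultimately show ?thesis by (simp add: zero_le_mult_iff inner_diff_right)
  qed
  then show "\<forall>\<^sub>F \<psi> in at_right \<theta>. tvec \<theta> \<bullet> y \<le> tvec \<theta> \<bullet> xl (sl \<psi>)"
    by (auto simp: eventually_at_right[of \<theta> "\<theta> + pi / 2"] intro!: exI[of _ "\<theta> + pi / 2"])
qed simp

text \<open>A face is run through once, with unit speed and ending at its top; so along it the
  parametrization is affine.\<close>

lemma xl_on_face:
  assumes a: "sl_left \<theta> \<le> a" "a \<le> sl \<theta>"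
  shows "xl a = xl (sl \<theta>) - (sl \<theta> - a) *\<^sub>R tvec \<theta>"
proof -
  define f where "f p = tvec \<theta> \<bullet> xl p" for p
  let ?I = "{sl_left \<theta>..sl \<theta>}"
  have n0: "nvec \<theta> \<bullet> (xl q - xl p) = 0" if "p \<in> ?I" "q \<in> ?I" for p q
    using xl_in_face[of \<theta> p] xl_in_face[of \<theta> q] that by (simp add: face_def inner_diff_right)
  have chord: "xl q - xl p = (f q - f p) *\<^sub>R tvec \<theta>" if "p \<in> ?I" "q \<in> ?I" for p q
    using frame_decompose[of "xl q - xl p" \<theta>]
    by (simp only: n0[OF that] f_def inner_diff_right[symmetric] scaleR_zero_left add_0)
  have inj: "inj_on f ?I"
  proof (rule inj_onI)
    fix p q assume pq: "p \<in> ?I" "q \<in> ?I" "f p = f q"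
    then have "xl p = xl q" using chord[of p q] by simp
    then show "p = q" using inj_onD[OF bij_betw_imp_inj_on[OF face_param]] pq by blast
  qed
  have cont: "continuous_on S f" for S
    unfolding f_def by (auto simp: continuous_on_def intro!: tendsto_intros xl_tendsto)
  have top: "f p \<le> f (sl \<theta>)" if "p \<in> ?I" for p
    unfolding f_def by (rule contact_is_top) (use xl_in_face that in auto)
  have mono: "f p \<le> f q" if pq: "p \<in> ?I" "q \<in> ?I" "p \<le> q" for p q
  proof (rule ccontr)
    assume n: "\<not> f p \<le> f q"
    then have "p < q" "q < sl \<theta>" using pq top[of p] by (force simp: order_less_le)+
    then have "f p < f q \<and> f q < f (sl \<theta>) \<or> f (sl \<theta>) < f q \<and> f q < f p"
      using pq by (intro continuous_inj_imp_mono cont inj_on_subset[OF inj]) auto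
    then show False using n top[OF pq(1)] by linarith
  qed
  have "1 * (sl \<theta> - a) \<le> tvec \<theta> \<bullet> (xl (sl \<theta>) - xl a)"
  proof (rule arc_progress[OF a(2)])
    fix p q assume pq: "a \<le> p" "p \<le> q" "q \<le> sl \<theta>"
    then have "f p \<le> f q" and "xl q - xl p = (f q - f p) *\<^sub>R tvec \<theta>"
      using a mono[of p q] chord[of p q] by auto
    then show "1 * dist (xl p) (xl q) \<le> tvec \<theta> \<bullet> (xl q - xl p)"
      by (simp add: dist_norm norm_minus_commute[of "xl p"] tvec_inner_tvec)
  qed simp
  moreover have "tvec \<theta> \<bullet> (xl (sl \<theta>) - xl a) \<le> sl \<theta> - a"
    using tvec_inner_le_norm[of \<theta> "xl (sl \<theta>) - xl a"] xl_lipschitz[of "sl \<theta>" a] a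
    by (simp add: dist_norm)
  ultimately have eq: "f (sl \<theta>) - f a = sl \<theta> - a" by (simp add: f_def inner_diff_right)
  have "xl (sl \<theta>) - xl a = (sl \<theta> - a) *\<^sub>R tvec \<theta>"
    unfolding eq[symmetric] by (rule chord) (use a in auto)
  then show ?thesis by (simp only: algebra_simps)
qed

text \<open>The least direction \<open>\<psi>\<close> with \<open>a \<le> sl \<psi>\<close> exists by right-continuity. The hypothesis
  \<open>sl \<theta> \<le> a\<close> ensures that the left limit at this direction is at most \<open>a\<close> even if \<open>\<psi> = \<theta>\<close>. So
  \<open>xl a\<close> lies on a face of intermediate direction.\<close>

lemma arc_direction:
  assumes "\<theta> \<le> \<theta>1" "sl \<theta> \<le> a" "a \<le> sl \<theta>1"
  obtains \<psi> where "\<theta> \<le> \<psi>" "\<psi> \<le> \<theta>1" "sl_left \<psi> \<le> a" "a \<le> sl \<psi>"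
proof -
  let ?S = "{\<psi>\<in>{\<theta>..\<theta>1}. a \<le> sl \<psi>}"
  define \<psi> where "\<psi> = Inf ?S"
  have bdd: "bdd_below ?S" by (auto intro!: bdd_belowI[of _ \<theta>])
  have ne: "\<theta>1 \<in> ?S" using assms by auto
  have "\<theta> \<le> \<psi>" unfolding \<psi>_def by (rule cInf_greatest) (use ne in auto)
  moreover have "\<psi> \<le> \<theta>1" unfolding \<psi>_def by (rule cInf_lower[OF ne bdd])
  ultimately have b: "\<theta> \<le> \<psi>" "\<psi> \<le> \<theta>1" .
  have "sl_left \<psi> \<le> a"
  proof (rule sl_left_le)
    fix y assume y: "y < \<psi>"
    then have "y \<notin> ?S" using cInf_lower[OF _ bdd] unfolding \<psi>_def by fastforce
    then show "sl y \<le> a" using y b sl_mono[of y \<theta>] assms(2) by (cases "y < \<theta>") auto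
  qed
  moreover have "a \<le> sl \<psi>"
  proof (rule ccontr)
    assume "\<not> a \<le> sl \<psi>"
    then have "\<forall>\<^sub>F x in at_right \<psi>. sl x < a"
      using order_tendstoD(2)[OF sl_tendsto_right] by simp
    then obtain c where c: "c > \<psi>" "\<And>x. \<psi> < x \<Longrightarrow> x < c \<Longrightarrow> sl x < a"
      by (auto simp: eventually_at_right[of \<psi> "\<psi> + 1"])
    obtain x where x: "x \<in> ?S" "x < c"
      using cInf_lessD[of ?S c] ne c unfolding \<psi>_def by blast
    moreover have "\<psi> \<le> x" unfolding \<psi>_def using cInf_lower[OF x(1) bdd] .
    ultimately show False using c(2)[of x] \<open>\<not> a \<le> sl \<psi>\<close> by (cases "x = \<psi>") auto
  qed
  ultimately show ?thesis using that b by blast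
qed

text \<open>While the direction turns from \<open>\<theta>\<close> to \<open>\<theta>1\<close>, all chords of the arc have directions between
  the two, so the arc advances along \<open>tvec \<theta>\<close> by at least its length times the cosine of the
  turning angle.\<close>

lemma contact_progress:
  assumes th: "\<theta> \<le> \<theta>1" "\<theta>1 - \<theta> < pi / 2"
  shows "cos (\<theta>1 - \<theta>) * (sl \<theta>1 - sl \<theta>) \<le> tvec \<theta> \<bullet> (xl (sl \<theta>1) - xl (sl \<theta>))"
proof (rule arc_progress[OF sl_mono[OF th(1)]])
  show c: "cos (\<theta>1 - \<theta>) > 0" using th by (intro cos_gt_zero_pi) auto
  have cos_le: "cos (\<theta>1 - \<theta>) \<le> cos (\<psi> - \<theta>)" if "\<theta> \<le> \<psi>" "\<psi> \<le> \<theta>1" for \<psi>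
    using that th by (intro cos_monotone_0_pi_le) auto
  fix p q assume pq: "sl \<theta> \<le> p" "p \<le> q" "q \<le> sl \<theta>1"
  obtain a where a: "\<theta> \<le> a" "a \<le> \<theta>1" "sl_left a \<le> p" "p \<le> sl a"
    using arc_direction[OF th(1) pq(1) order_trans[OF pq(2,3)]] .
  obtain b where b: "\<theta> \<le> b" "b \<le> \<theta>1" "sl_left b \<le> q" "q \<le> sl b"
    using arc_direction[OF th(1) order_trans[OF pq(1,2)] pq(3)] .
  show "cos (\<theta>1 - \<theta>) * dist (xl p) (xl q) \<le> tvec \<theta> \<bullet> (xl q - xl p)"
  proof (cases "a < b")
    case True
    have "nvec a \<bullet> (xl q - xl p) \<le> 0" "nvec b \<bullet> (xl q - xl p) \<ge> 0"
      using faceD[OF xl_in_face[OF a(3,4)]] faceD[OF xl_in_face[OF b(3,4)]] support_fun_ge[OF body]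
      by (simp_all add: inner_diff_right)
    then have "cos (\<theta>1 - \<theta>) * norm (xl q - xl p) \<le> tvec \<theta> \<bullet> (xl q - xl p)"
      using True th a b c by (intro cone_between_tangents[of b a] cos_le) auto
    then show ?thesis by (simp add: dist_norm norm_minus_commute)
  next
    case False
    show ?thesis
    proof (cases "p = q")
      case neq: False
      have "b = a"
      proof (rule ccontr)
        assume "b \<noteq> a"
        then have "sl b \<le> sl_left a" using False by (intro sl_left_ge) auto
        then show False using a b pq neq by linarith
      qed
      then have "sl_left a \<le> q" "q \<le> sl a" using b by auto
      then have "xl q - xl p
          = (xl (sl a) - (sl a - q) *\<^sub>R tvec a) - (xl (sl a) - (sl a - p) *\<^sub>R tvec a)"
        by (intro arg_cong2[of _ _ _ _ minus] xl_on_face a)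
      also have "\<dots> = (q - p) *\<^sub>R tvec a" by (simp add: algebra_simps)
      finally have "xl q - xl p = (q - p) *\<^sub>R tvec a" .
      then show ?thesis using pq cos_le[OF a(1,2)]
        by (simp add: dist_norm norm_minus_commute[of "xl p"] tvec_inner_tvec
            cos_diff_commute[of \<theta> a] mult.commute mult_left_mono)
    qed simp
  qed
qed

text \<open>If \<open>\<theta>\<close> is the direction of the left tangent through \<open>x\<close>, this is the starting parameter of the
  left involute through \<open>x\<close>: the end of the string from \<open>x\<close> to the contact point after it has been
  wound back onto the boundary.\<close>

definition unwound :: "real^2 \<Rightarrow> real \<Rightarrow> real" where
  "unwound x \<theta> = sl \<theta> - dist x (xl (sl \<theta>))"

lemma unwound_back:
  assumes "\<theta>1 \<le> \<theta>" "dist x (xl (sl \<theta>1)) \<le> dist x1 (xl (sl \<theta>1))"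
  shows "unwound x1 \<theta>1 \<le> unwound x \<theta>"
  using dist_triangle[of x "xl (sl \<theta>)" "xl (sl \<theta>1)"] xl_lipschitz[of "sl \<theta>" "sl \<theta>1"]
    sl_mono[OF assms(1)] assms(2) by (simp add: unwound_def dist_commute)

text \<open>The distance from \<open>x\<close> to the new contact point is at least the component along \<open>tvec \<theta>\<close>. The
  segment to the old contact point has this direction, and the arc that follows deviates from it by
  at most the turning angle.\<close>

lemma unwound_step:
  assumes "separates K x \<phi>" "left_tangent K x \<phi> \<theta>" "\<theta> \<le> \<theta>1" "\<theta>1 - \<theta> < pi / 2"
    and "dist x (xl (sl \<theta>1)) \<le> dist x1 (xl (sl \<theta>1))"
  shows "unwound x1 \<theta>1 \<le> unwound x \<theta> + (1 - cos (\<theta>1 - \<theta>)) * (sl \<theta>1 - sl \<theta>)"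
proof -
  have "dist x (xl (sl \<theta>)) + cos (\<theta>1 - \<theta>) * (sl \<theta>1 - sl \<theta>)
      \<le> tvec \<theta> \<bullet> (xl (sl \<theta>) - x) + tvec \<theta> \<bullet> (xl (sl \<theta>1) - xl (sl \<theta>))"
    using left_tangent_contact(1)[OF assms(1,2) contact_in_face] contact_progress[OF assms(3,4)] by simp
  also have "\<dots> = tvec \<theta> \<bullet> (xl (sl \<theta>1) - x)" by (simp add: inner_diff_right)
  also have "\<dots> \<le> dist x (xl (sl \<theta>1))"
    using tvec_inner_le_norm[of \<theta> "xl (sl \<theta>1) - x"] by (simp add: dist_norm norm_minus_commute)
  finally show ?thesis using assms(5) by (simp add: unwound_def algebra_simps)
qed

text \<open>The contact point may jump along a face, but then the string and the arc change by the same
  length, since \<open>x\<close> and the face are collinear.\<close>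

lemma unwound_isCont:
  assumes sep: "separates K x \<phi>" and lt: "left_tangent K x \<phi> \<theta>"
  shows "isCont (unwound x) \<theta>"
proof -
  have r: "(unwound x \<longlongrightarrow> unwound x \<theta>) (at_right \<theta>)"
    unfolding unwound_def by (intro tendsto_intros xl_tendsto sl_tendsto_right)
  have "(unwound x \<longlongrightarrow> sl_left \<theta> - dist x (xl (sl_left \<theta>))) (at_left \<theta>)"
    unfolding unwound_def by (intro tendsto_intros xl_tendsto sl_tendsto_left)
  moreover have "sl_left \<theta> - dist x (xl (sl_left \<theta>)) = unwound x \<theta>"
  proof -
    have "tvec \<theta> \<bullet> (xl (sl_left \<theta>) - x) = dist x (xl (sl_left \<theta>))"
      by (intro left_tangent_contact(1)[OF sep lt] xl_in_face sl_left_le_sl order_refl)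
    moreover have "xl (sl_left \<theta>) = xl (sl \<theta>) - (sl \<theta> - sl_left \<theta>) *\<^sub>R tvec \<theta>"
      by (intro xl_on_face sl_left_le_sl order_refl)
    ultimately have "dist x (xl (sl_left \<theta>)) = dist x (xl (sl \<theta>)) - (sl \<theta> - sl_left \<theta>)"
      using left_tangent_contact(1)[OF sep lt contact_in_face]
      by (simp add: inner_diff_right tvec_inner_tvec)
    then show ?thesis by (simp add: unwound_def)
  qed
  ultimately show ?thesis using r by (simp add: isCont_def filterlim_at_split)
qed

end


section \<open>Unwinding along a receding curve\<close>

text \<open>Connected order intervals take the place of a parametrization: they provide intermediate values
  along the curve.\<close>

definition recedes :: "(real^2) set \<Rightarrow> (real^2) set \<Rightarrow> (real^2) rel \<Rightarrow> bool" where
  "recedes K \<gamma> r \<longleftrightarrow> trans r \<and> (\<forall>x\<in>\<gamma>. (x, x) \<in> r) \<and>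
     (\<forall>x\<in>\<gamma>. \<forall>x1\<in>\<gamma>. (x, x1) \<in> r \<longrightarrow>
        connected {z\<in>\<gamma>. (x, z) \<in> r \<and> (z, x1) \<in> r} \<and> (\<forall>y\<in>K. dist x y \<le> dist x1 y))"

lemma recedesD:
  assumes "recedes K \<gamma> r" "x \<in> \<gamma>" "x1 \<in> \<gamma>" "(x, x1) \<in> r"
  shows "connected {z\<in>\<gamma>. (x, z) \<in> r \<and> (z, x1) \<in> r}" "y \<in> K \<Longrightarrow> dist x y \<le> dist x1 y"
  using assms by (auto simp: recedes_def)

text \<open>The points \<open>x\<close> and \<open>x1\<close> lie on different sides of the tangent line with direction \<open>\<theta>'\<close>, and
  the curve is connected.\<close>

lemma recedes_hits_tangent:
  assumes K: "convex_body K" and rec: "recedes K \<gamma> r"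
    and x: "x \<in> \<gamma>" "x1 \<in> \<gamma>" "(x, x1) \<in> r"
    and sep: "\<And>z. z \<in> \<gamma> \<Longrightarrow> (x, z) \<in> r \<Longrightarrow> (z, x1) \<in> r \<Longrightarrow> separates K z \<phi>"
    and lt: "left_tangent K x \<phi> \<theta>" "left_tangent K x1 \<phi> \<theta>1" and th: "\<theta> < \<theta>'" "\<theta>' \<le> \<theta>1"
  obtains z where "z \<in> \<gamma>" "(x, z) \<in> r" "(z, x1) \<in> r" "left_tangent K z \<phi> \<theta>'"
proof -
  let ?I = "{z\<in>\<gamma>. (x, z) \<in> r \<and> (z, x1) \<in> r}"
  have ends: "x \<in> ?I" "x1 \<in> ?I" using rec x by (auto simp: recedes_def)
  have b: "\<phi> < \<theta>'" "\<theta>' < \<phi> + pi" using lt th by (auto simp: left_tangent_def)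
  have "nvec \<theta>' \<bullet> x < support_fun K \<theta>'"
    using lt(1) th b ends by (intro not_separates_turn[OF K sep]) (auto simp: left_tangent_def)
  moreover have "support_fun K \<theta>' \<le> nvec \<theta>' \<bullet> x1"
  proof (cases "\<theta>' = \<theta>1")
    case False
    then have "separates K x1 \<theta>'"
      using th b ends by (intro separates_before_left_tangent[OF K sep lt(2)]) auto
    then show ?thesis using K by (simp add: separates_iff_support_fun)
  qed (use lt in \<open>simp add: left_tangent_def\<close>)
  ultimately obtain z where "z \<in> ?I" "nvec \<theta>' \<bullet> z = support_fun K \<theta>'"
    using connected_ivt_hyperplane[OF recedesD(1)[OF rec x] ends, of "nvec \<theta>'" "support_fun K \<theta>'"]
    by auto
  then show ?thesis using that b by (auto simp: left_tangent_def)
qed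

context left_unwinding
begin

text \<open>The lengths of the arcs in the errors of the single steps add up to the length of the whole
  arc.\<close>

lemma unwound_steps:
  assumes rec: "recedes K \<gamma> r" and d: "0 < d" "d < pi / 2"
    and x: "x \<in> \<gamma>" "x1 \<in> \<gamma>" "(x, x1) \<in> r"
    and sep: "\<And>z. z \<in> \<gamma> \<Longrightarrow> (x, z) \<in> r \<Longrightarrow> (z, x1) \<in> r \<Longrightarrow> separates K z \<phi>"
    and lt: "left_tangent K x \<phi> \<theta>" "left_tangent K x1 \<phi> \<theta>1" and n: "\<theta>1 = \<theta> + real n * d"
  shows "unwound x1 \<theta>1 \<le> unwound x \<theta> + (1 - cos d) * (sl \<theta>1 - sl \<theta>)"
  using x sep lt n
proof (induction n arbitrary: x \<theta>)
  case 0
  then show ?case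
    using unwound_back[of \<theta>1 \<theta> x x1] recedesD(2)[OF rec 0(1-3) contact_in_body] by simp
next
  case (Suc n)
  have le: "\<theta> + d \<le> \<theta>1" using Suc.prems d by (simp add: algebra_simps)
  obtain z where z: "z \<in> \<gamma>" "(x, z) \<in> r" "(z, x1) \<in> r" "left_tangent K z \<phi> (\<theta> + d)"
    using recedes_hits_tangent[OF body rec Suc.prems(1-3) Suc.prems(4-6) _ le] d by auto
  have tr: "trans r" and re: "(x, x) \<in> r" using rec Suc.prems by (auto simp: recedes_def)
  have "unwound x1 \<theta>1 \<le> unwound z (\<theta> + d) + (1 - cos d) * (sl \<theta>1 - sl (\<theta> + d))"
    using z Suc.prems transD[OF tr z(2)]
    by (intro Suc.IH) (auto simp: algebra_simps)
  moreover have "unwound z (\<theta> + d) \<le> unwound x \<theta> + (1 - cos d) * (sl (\<theta> + d) - sl \<theta>)"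
    using unwound_step[of x \<phi> \<theta> "\<theta> + d" z] Suc.prems(3-5) Suc.prems(1) re d
      recedesD(2)[OF rec Suc.prems(1) z(1,2) contact_in_body] by simp
  ultimately show ?case by (simp add: algebra_simps)
qed

text \<open>The error \<open>1 - cos d\<close> of a step is of second order in the turning angle \<open>d\<close>, so the factor in
  front of the total length of the arc vanishes as the number of steps grows.\<close>

lemma unwound_decreasing:
  assumes rec: "recedes K \<gamma> r" and x: "x \<in> \<gamma>" "x1 \<in> \<gamma>" "(x, x1) \<in> r"
    and sep: "\<And>z. z \<in> \<gamma> \<Longrightarrow> (x, z) \<in> r \<Longrightarrow> (z, x1) \<in> r \<Longrightarrow> separates K z \<phi>"
    and lt: "left_tangent K x \<phi> \<theta>" "left_tangent K x1 \<phi> \<theta>1"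
  shows "unwound x1 \<theta>1 \<le> unwound x \<theta>"
proof (cases "\<theta>1 \<le> \<theta>")
  case True
  then show ?thesis by (rule unwound_back) (rule recedesD(2)[OF rec x contact_in_body])
next
  case False
  let ?d = "\<lambda>n. (\<theta>1 - \<theta>) / real n"
  have d: "?d \<longlonglongrightarrow> 0" by (rule lim_const_over_n)
  have "(\<lambda>n. unwound x \<theta> + (1 - cos (?d n)) * (sl \<theta>1 - sl \<theta>))
      \<longlonglongrightarrow> unwound x \<theta> + (1 - cos 0) * (sl \<theta>1 - sl \<theta>)"
    by (intro tendsto_intros d)
  moreover have "\<forall>\<^sub>F n in sequentially.
      unwound x1 \<theta>1 \<le> unwound x \<theta> + (1 - cos (?d n)) * (sl \<theta>1 - sl \<theta>)"
    using order_tendstoD(2)[OF d, of "pi / 2", OF pi_half_gt_zero] eventually_gt_at_top[of 0]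
  proof eventually_elim
    case (elim n)
    then show ?case using False
      by (intro unwound_steps[OF rec _ _ x sep lt, of _ n]) auto
  qed
  ultimately have "unwound x1 \<theta>1 \<le> unwound x \<theta> + (1 - cos 0) * (sl \<theta>1 - sl \<theta>)"
    by (rule tendsto_lowerbound) simp
  then show ?thesis by simp
qed

text \<open>This is the inequality that defines the left involute from \<open>\<sigma>\<close> as the outer boundary of the
  fence; it does not bound the direction of the tangent.\<close>

definition left_reach :: "real \<Rightarrow> real^2 \<Rightarrow> real \<Rightarrow> bool" where
  "left_reach \<sigma> x \<phi> \<longleftrightarrow> (\<exists>\<theta>. left_tangent K x \<phi> \<theta> \<and> \<sigma> \<le> unwound x \<theta>)"

lemma left_reach_backward:
  assumes "recedes K \<gamma> r" "x \<in> \<gamma>" "x1 \<in> \<gamma>" "(x, x1) \<in> r"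
    and sep: "\<And>z. z \<in> \<gamma> \<Longrightarrow> (x, z) \<in> r \<Longrightarrow> (z, x1) \<in> r \<Longrightarrow> separates K z \<phi>"
    and reach: "left_reach \<sigma> x1 \<phi>"
  shows "left_reach \<sigma> x \<phi>"
proof -
  obtain \<theta>1 where 1: "left_tangent K x1 \<phi> \<theta>1" "\<sigma> \<le> unwound x1 \<theta>1"
    using reach by (auto simp: left_reach_def)
  have "separates K x \<phi>" using assms by (intro sep) (auto simp: recedes_def)
  then obtain \<theta> where 2: "left_tangent K x \<phi> \<theta>" using left_tangent_exists[OF body] by blast
  from unwound_decreasing[OF assms(1-4) sep 2 1(1)] 1(2) 2 show ?thesis
    unfolding left_reach_def by (intro exI[of _ \<theta>]) auto
qed

lemma left_reach_shift:
  assumes "left_reach \<sigma> x \<phi>" "separates K x \<phi>" "separates K x \<phi>'" "\<bar>\<phi>' - \<phi>\<bar> < pi"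
  shows "left_reach \<sigma> x \<phi>'"
  using assms left_tangent_shift[OF body assms(2-4)] by (auto simp: left_reach_def)


section \<open>The left fence\<close>

lemma sl_add_periods: "sl (\<theta> + 2 * pi * real n) = sl \<theta> + real n * L"
proof (induction n)
  case (Suc n)
  have "sl (\<theta> + 2 * pi * real (Suc n)) = sl ((\<theta> + 2 * pi * real n) + 2 * pi)"
    by (simp add: algebra_simps)
  also have "\<dots> = sl (\<theta> + 2 * pi * real n) + L" using sys unfolding left_system_def by blast
  finally show ?case using Suc by (simp add: algebra_simps)
qed simp

lemma sl_unbounded: "\<exists>\<theta>. \<sigma> < sl \<theta>" "\<exists>\<theta>. sl \<theta> \<le> \<sigma>"
proof -
  have L: "L > 0" using sys by (auto simp: left_system_def boundary_param_def)
  obtain n where "\<bar>\<sigma>\<bar> + \<bar>sl 0\<bar> < real n * L" using ex_less_of_nat_mult[OF L] by blast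
  moreover have "sl (2 * pi * real n) = sl 0 + real n * L" "sl 0 = sl (- (2 * pi * real n)) + real n * L"
    using sl_add_periods[of 0 n] sl_add_periods[of "- (2 * pi * real n)" n] by simp_all
  ultimately have "\<sigma> < sl (2 * pi * real n)" "sl (- (2 * pi * real n)) \<le> \<sigma>" by linarith+
  then show "\<exists>\<theta>. \<sigma> < sl \<theta>" "\<exists>\<theta>. sl \<theta> \<le> \<sigma>" by blast+
qed

lemma left_start_bdd: "bdd_below {\<theta>. \<sigma> < sl \<theta>}"
proof -
  obtain a where a: "sl a \<le> \<sigma>" using sl_unbounded(2) by blast
  have "a \<le> \<theta>" if "\<sigma> < sl \<theta>" for \<theta>
    using sl_mono[of \<theta> a] a that by linarith
  then show ?thesis by (intro bdd_belowI[of _ a]) auto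
qed

lemma left_start_le: "\<sigma> < sl \<theta> \<Longrightarrow> left_start sl \<sigma> \<le> \<theta>"
  unfolding left_start_def by (intro cInf_lower left_start_bdd) auto

lemma sl_before_start: "\<theta> < left_start sl \<sigma> \<Longrightarrow> sl \<theta> \<le> \<sigma>"
  using left_start_le[of \<sigma> \<theta>] by linarith

lemma sl_after_start:
  assumes "left_start sl \<sigma> \<le> \<theta>" shows "\<sigma> \<le> sl \<theta>"
proof -
  have gt: "\<sigma> \<le> sl \<psi>" if "left_start sl \<sigma> < \<psi>" for \<psi>
  proof -
    have "{\<theta>. \<sigma> < sl \<theta>} \<noteq> {}" using sl_unbounded(1) by blast
    from cInf_lessD[OF this that[unfolded left_start_def]]
    obtain s where "\<sigma> < sl s" "s < \<psi>" by blast
    then show ?thesis using sl_mono[of s \<psi>] by linarith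
  qed
  show ?thesis
    by (rule tendsto_lowerbound[OF sl_tendsto_right[of \<theta>]])
      (auto simp: eventually_at_right[of \<theta> "\<theta> + 1"] intro!: exI[of _ "\<theta> + 1"] gt order_le_less_trans[OF assms])
qed

lemma in_left_fence_iff:
  "x \<in> left_fence K xl sl \<sigma> \<theta>l \<longleftrightarrow> x \<notin> K \<and>
     (\<exists>\<theta> \<rho>. left_start sl \<sigma> < \<theta> \<and> \<theta> < \<theta>l \<and> 0 < \<rho> \<and> \<rho> < sl \<theta> - \<sigma> \<and> x = xl (sl \<theta>) - \<rho> *\<^sub>R tvec \<theta>)"
  (is "_ \<longleftrightarrow> _ \<and> ?R")
proof -
  have seg: "t *\<^sub>R xl (sl \<theta>) + (1 - t) *\<^sub>R left_involute xl sl \<sigma> \<theta>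
      = xl (sl \<theta>) - ((1 - t) * (sl \<theta> - \<sigma>)) *\<^sub>R tvec \<theta>" for t \<theta>
    by (simp add: left_involute_def algebra_simps)
  show ?thesis
  proof
    assume "x \<in> left_fence K xl sl \<sigma> \<theta>l"
    then obtain t \<theta> where x: "x \<notin> K" "0 < t" "t < 1" "left_start sl \<sigma> < \<theta>" "\<theta> < \<theta>l"
      and eq: "x = xl (sl \<theta>) - ((1 - t) * (sl \<theta> - \<sigma>)) *\<^sub>R tvec \<theta>"
      unfolding left_fence_def seg by auto
    have "sl \<theta> \<noteq> \<sigma>" using eq contact_in_body[of \<theta>] x by auto
    then have "\<sigma> < sl \<theta>" using sl_after_start[of \<sigma> \<theta>] x by simp
    then have "0 < (1 - t) * (sl \<theta> - \<sigma>)" "(1 - t) * (sl \<theta> - \<sigma>) < sl \<theta> - \<sigma>"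
      using x mult_strict_right_mono[of "1 - t" 1 "sl \<theta> - \<sigma>"] by auto
    with x eq show "x \<notin> K \<and> ?R" by blast
  next
    assume "x \<notin> K \<and> ?R"
    then obtain \<theta> \<rho> where x: "x \<notin> K" "left_start sl \<sigma> < \<theta>" "\<theta> < \<theta>l" "0 < \<rho>" "\<rho> < sl \<theta> - \<sigma>"
      and eq: "x = xl (sl \<theta>) - \<rho> *\<^sub>R tvec \<theta>" by blast
    have "x = xl (sl \<theta>) - ((1 - (1 - \<rho> / (sl \<theta> - \<sigma>))) * (sl \<theta> - \<sigma>)) *\<^sub>R tvec \<theta>"
      using x eq by simp
    moreover have "0 < 1 - \<rho> / (sl \<theta> - \<sigma>)" "1 - \<rho> / (sl \<theta> - \<sigma>) < 1" using x by auto
    ultimately show "x \<in> left_fence K xl sl \<sigma> \<theta>l"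
      using x unfolding left_fence_def seg by blast
  qed
qed

text \<open>The tangent direction and the end of the unwound string depend continuously on the point, so
  the strict inequalities that describe the fence persist nearby.\<close>

lemma open_left_fence: "open (left_fence K xl sl \<sigma> \<theta>l)"
proof (subst open_subopen, rule ballI)
  fix x assume x: "x \<in> left_fence K xl sl \<sigma> \<theta>l"
  then obtain \<theta> \<rho> where nK: "x \<notin> K" and th: "left_start sl \<sigma> < \<theta>" "\<theta> < \<theta>l" "0 < \<rho>" "\<rho> < sl \<theta> - \<sigma>"
    and eq: "x = xl (sl \<theta>) - \<rho> *\<^sub>R tvec \<theta>" unfolding in_left_fence_iff by blast
  obtain \<phi>0 e where e: "e > 0" "\<And>z. dist x z < e \<Longrightarrow> separates K z \<phi>0"
    using separates_nearby[OF body nK] by blast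
  obtain k where "\<bar>\<phi>0 + 2 * pi * of_int k - (\<theta> - pi / 2)\<bar> \<le> pi" using angle_shift_near by blast
  then obtain \<phi> where near: "\<bar>\<phi> - (\<theta> - pi / 2)\<bar> \<le> pi"
    and sep: "\<And>z. dist x z < e \<Longrightarrow> separates K z \<phi>" using e separates_2pi_int by metis
  have sepx: "separates K x \<phi>" using sep e by simp
  have lt: "left_tangent K x \<phi> \<theta>"
    using th near by (intro left_tangentI[OF sepx contact_in_face eq]) auto
  have "unwound x \<theta> > \<sigma>" using th by (simp add: unwound_def eq dist_norm)
  define \<eta> where "\<eta> = (unwound x \<theta> - \<sigma>) / 2"
  have eta: "\<eta> > 0" "unwound x \<theta> > \<sigma> + \<eta>"
    using \<open>unwound x \<theta> > \<sigma>\<close> by (auto simp: \<eta>_def field_simps)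
  have "(unwound x \<longlongrightarrow> unwound x \<theta>) (at \<theta>)"
    using unwound_isCont[OF sepx lt] by (simp add: isCont_def)
  then have "\<forall>\<^sub>F \<psi> in at \<theta>. unwound x \<psi> > \<sigma> + \<eta>" by (rule order_tendstoD) (rule eta)
  then obtain d where d: "d > 0" "\<And>\<psi>. dist \<psi> \<theta> < d \<Longrightarrow> unwound x \<psi> > \<sigma> + \<eta>"
    unfolding eventually_at using eta by (metis UNIV_I)
  define m where "m = Min {d, \<theta> - \<phi>, \<phi> + pi - \<theta>, \<theta> - left_start sl \<sigma>, \<theta>l - \<theta>}"
  have m: "m \<le> d" "m \<le> \<theta> - \<phi>" "m \<le> \<phi> + pi - \<theta>" "m \<le> \<theta> - left_start sl \<sigma>" "m \<le> \<theta>l - \<theta>"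
    unfolding m_def by (rule Min_le; simp)+
  have "m > 0" unfolding m_def using d th lt by (simp add: left_tangent_def)
  define \<delta> where "\<delta> = m / 2"
  have del: "0 < \<delta>" "\<delta> < d" "\<phi> < \<theta> - \<delta>" "\<theta> + \<delta> < \<phi> + pi" "left_start sl \<sigma> < \<theta> - \<delta>" "\<theta> + \<delta> < \<theta>l"
    using m \<open>m > 0\<close> unfolding \<delta>_def by linarith+
  \<comment> \<open>The direction \<open>?a\<close> separates \<open>x\<close> and \<open>?b\<close> does not; both properties are open, so the tangent
    directions of nearby points stay between the two.\<close>
  let ?a = "\<theta> - \<delta>" and ?b = "\<theta> + \<delta>"
  define T where "T = ball x (min e \<eta>) \<inter> {z. nvec ?a \<bullet> z > support_fun K ?a}
      \<inter> {z. nvec ?b \<bullet> z < support_fun K ?b}"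
  have "open T" unfolding T_def by (intro open_Int open_ball open_halfspace_gt open_halfspace_lt)
  moreover have "x \<in> T"
  proof -
    have "separates K x ?a" using del by (intro separates_before_left_tangent[OF body sepx lt]) auto
    moreover have "nvec ?b \<bullet> x < support_fun K ?b"
      using lt del by (intro not_separates_turn[OF body sepx, of \<theta>]) (auto simp: left_tangent_def)
    ultimately show ?thesis using e eta body by (simp add: T_def separates_iff_support_fun)
  qed
  moreover have "T \<subseteq> left_fence K xl sl \<sigma> \<theta>l"
  proof
    fix z assume z: "z \<in> T"
    then have sepz: "separates K z \<phi>" using sep by (simp add: T_def)
    obtain \<psi> where lz: "left_tangent K z \<phi> \<psi>" using left_tangent_exists[OF body sepz] .
    have "?a < \<psi>"
    proof (rule ccontr)
      assume "\<not> ?a < \<psi>"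
      then consider "\<psi> = ?a" | "\<psi> < ?a" by linarith
      then have "\<psi> = ?a \<or> nvec ?a \<bullet> z < support_fun K ?a"
        using lz del not_separates_turn[OF body sepz, of \<psi> ?a] by cases (auto simp: left_tangent_def)
      then show False using z lz by (auto simp: T_def left_tangent_def)
    qed
    moreover have "\<psi> < ?b"
    proof (rule ccontr)
      assume "\<not> \<psi> < ?b"
      then consider "\<psi> = ?b" | "?b < \<psi>" by linarith
      then have "\<psi> = ?b \<or> separates K z ?b"
        using del separates_before_left_tangent[OF body sepz lz, of ?b] by cases auto
      then show False using z lz body by (auto simp: T_def left_tangent_def separates_iff_support_fun)
    qed
    ultimately have psi: "?a < \<psi>" "\<psi> < ?b" .
    then have "unwound x \<psi> > \<sigma> + \<eta>" using del by (intro d(2)) (auto simp: dist_real_def)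
    moreover have "dist z (xl (sl \<psi>)) \<le> dist x z + dist x (xl (sl \<psi>))"
      by (metis dist_commute dist_triangle)
    moreover have "dist x z < \<eta>" using z by (simp add: T_def)
    ultimately have "dist z (xl (sl \<psi>)) < sl \<psi> - \<sigma>" by (simp add: unwound_def)
    then show "z \<in> left_fence K xl sl \<sigma> \<theta>l"
      using left_tangent_contact[OF sepz lz contact_in_face] psi del separates_notin[OF sepz]
      unfolding in_left_fence_iff
      by (intro conjI exI[of _ \<psi>] exI[of _ "dist z (xl (sl \<psi>))"]) auto
  qed
  ultimately show "\<exists>T. open T \<and> x \<in> T \<and> T \<subseteq> left_fence K xl sl \<sigma> \<theta>l" by blast
qed

text \<open>The fence is defined with strict inequalities for the direction and the length of the string,
  so the point has to be approximated. Directions slightly larger than \<open>\<theta>\<close> are available unless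
  \<open>\<theta> = \<theta>l\<close>. In that case smaller ones are used; their contact points tend to the near end of the
  face of \<open>\<theta>\<close>, and \<open>x\<close> lies before this end on the same line.\<close>

lemma left_reach_in_closure:
  assumes sep: "separates K x \<phi>" and lt: "left_tangent K x \<phi> \<theta>" and u: "\<sigma> \<le> unwound x \<theta>"
    and le: "\<theta> \<le> \<theta>l"
  shows "x \<in> closure (left_fence K xl sl \<sigma> \<theta>l)"
proof -
  let ?F = "left_fence K xl sl \<sigma> \<theta>l"
  let ?\<rho> = "dist x (xl (sl \<theta>))"
  note x = left_tangent_contact[OF sep lt contact_in_face]
  have rho: "?\<rho> \<le> sl \<theta> - \<sigma>" using u by (simp add: unwound_def)
  then have start: "left_start sl \<sigma> \<le> \<theta>" using left_start_le[of \<sigma> \<theta>] x(2) by linarith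
  have limit: "x \<in> closure ?F"
    if "(p \<longlongrightarrow> x) F" "F \<noteq> bot" "\<forall>\<^sub>F \<psi> in F. p \<psi> \<notin> K \<longrightarrow> p \<psi> \<in> ?F" for p :: "real \<Rightarrow> real^2" and F
  proof (rule Lim_in_closed_set[OF closed_closure _ that(2,1)])
    have "open (- K)" using body by (auto simp: convex_body_def intro: open_Compl compact_imp_closed)
    then have "\<forall>\<^sub>F \<psi> in F. p \<psi> \<in> - K"
      using separates_notin[OF sep] by (intro topological_tendstoD[OF that(1)]) auto
    with that(3) show "\<forall>\<^sub>F \<psi> in F. p \<psi> \<in> closure ?F"
      by eventually_elim (use closure_subset in auto)
  qed
  show ?thesis
  proof (cases "\<theta> < \<theta>l")
    case True
    \<comment> \<open>The factor \<open>1 - (\<psi> - \<theta>)\<close> makes the bound on the length of the string strict.\<close>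
    let ?p = "\<lambda>\<psi>. xl (sl \<psi>) - (?\<rho> * (1 - (\<psi> - \<theta>))) *\<^sub>R tvec \<psi>"
    have "(?p \<longlongrightarrow> xl (sl \<theta>) - (?\<rho> * (1 - (\<theta> - \<theta>))) *\<^sub>R tvec \<theta>) (at_right \<theta>)"
      by (intro tendsto_intros xl_tendsto sl_tendsto_right)
    then have "(?p \<longlongrightarrow> x) (at_right \<theta>)" using x(3) by simp
    moreover have "?p \<psi> \<in> ?F" if psi: "\<theta> < \<psi>" "\<psi> < min \<theta>l (\<theta> + 1)" "?p \<psi> \<notin> K" for \<psi>
    proof -
      have "0 < ?\<rho> * (1 - (\<psi> - \<theta>))" using psi x by (intro mult_pos_pos) auto
      moreover have "?\<rho> * (1 - (\<psi> - \<theta>)) < ?\<rho> * 1" using psi x by (intro mult_strict_left_mono) auto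
      moreover have "sl \<theta> \<le> sl \<psi>" using psi by (intro sl_mono) auto
      ultimately show ?thesis unfolding in_left_fence_iff using psi start rho
        by (intro conjI exI[of _ \<psi>] exI[of _ "?\<rho> * (1 - (\<psi> - \<theta>))"]) auto
    qed
    then have "\<forall>\<^sub>F \<psi> in at_right \<theta>. ?p \<psi> \<notin> K \<longrightarrow> ?p \<psi> \<in> ?F"
      using True by (subst eventually_at_right[of \<theta> "min \<theta>l (\<theta> + 1)"])
        (auto intro!: exI[of _ "min \<theta>l (\<theta> + 1)"])
    ultimately show ?thesis by (intro limit[of ?p "at_right \<theta>"]) auto
  next
    case False
    let ?u = "unwound x \<theta>"
    have t: "tvec \<theta> \<bullet> (xl (sl_left \<theta>) - x) = dist x (xl (sl_left \<theta>))" "0 < dist x (xl (sl_left \<theta>))"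
      by (rule left_tangent_contact[OF sep lt]; intro xl_in_face sl_left_le_sl order_refl)+
    have face: "xl (sl_left \<theta>) = xl (sl \<theta>) - (sl \<theta> - sl_left \<theta>) *\<^sub>R tvec \<theta>"
      by (intro xl_on_face sl_left_le_sl order_refl)
    have gap: "dist x (xl (sl_left \<theta>)) = sl_left \<theta> - ?u"
      using t(1) x(1) unfolding face unwound_def by (simp add: inner_diff_right tvec_inner_tvec)
    \<comment> \<open>If the involute started with direction \<open>\<theta>\<close>, its starting point and hence \<open>x\<close> would lie on
      the face of \<open>\<theta>\<close>.\<close>
    have "left_start sl \<sigma> \<noteq> \<theta>"
    proof
      assume "left_start sl \<sigma> = \<theta>"
      then have "sl_left \<theta> \<le> \<sigma>" by (intro sl_left_le sl_before_start) auto
      then show False using gap t u by simp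
    qed
    then have lt': "left_start sl \<sigma> < \<theta>" using start by simp
    \<comment> \<open>The end of the string is moved from \<open>?u\<close> to \<open>?u + (\<theta> - \<psi>)\<close>, strictly beyond \<open>\<sigma>\<close>.\<close>
    let ?r = "\<lambda>\<psi>. sl \<psi> - (?u + (\<theta> - \<psi>))"
    let ?p = "\<lambda>\<psi>. xl (sl \<psi>) - ?r \<psi> *\<^sub>R tvec \<psi>"
    have rlim: "(?r \<longlongrightarrow> sl_left \<theta> - (?u + (\<theta> - \<theta>))) (at_left \<theta>)"
      by (intro tendsto_intros sl_tendsto_left)
    then have "(?p \<longlongrightarrow> xl (sl_left \<theta>) - (sl_left \<theta> - (?u + (\<theta> - \<theta>))) *\<^sub>R tvec \<theta>) (at_left \<theta>)"
      by (intro tendsto_intros xl_tendsto sl_tendsto_left)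
    also have "xl (sl_left \<theta>) - (sl_left \<theta> - (?u + (\<theta> - \<theta>))) *\<^sub>R tvec \<theta> = xl (sl \<theta>) - ?\<rho> *\<^sub>R tvec \<theta>"
      unfolding face by (simp add: unwound_def algebra_simps)
    also have "\<dots> = x" using x(3) by simp
    finally have plim: "(?p \<longlongrightarrow> x) (at_left \<theta>)" .
    have "\<forall>\<^sub>F \<psi> in at_left \<theta>. 0 < ?r \<psi>"
      using t gap by (intro order_tendstoD(1)[OF rlim]) auto
    moreover have "\<forall>\<^sub>F \<psi> in at_left \<theta>. left_start sl \<sigma> < \<psi> \<and> \<psi> < \<theta>"
      using lt' by (auto simp: eventually_at_left[of "left_start sl \<sigma>"] intro!: exI[of _ "left_start sl \<sigma>"])
    ultimately have "\<forall>\<^sub>F \<psi> in at_left \<theta>. ?p \<psi> \<notin> K \<longrightarrow> ?p \<psi> \<in> ?F"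
    proof eventually_elim
      case (elim \<psi>)
      show ?case
      proof
        assume "?p \<psi> \<notin> K"
        with elim u le show "?p \<psi> \<in> ?F" unfolding in_left_fence_iff
          by (intro conjI exI[of _ \<psi>] exI[of _ "?r \<psi>"]) auto
      qed
    qed
    then show ?thesis using plim by (intro limit[of ?p "at_left \<theta>"]) auto
  qed
qed

lemma left_involute_tangent:
  assumes w: "w = left_involute xl sl \<sigma> \<theta>" and start: "left_start sl \<sigma> \<le> \<theta>"
    and sep: "separates K w \<phi>" and near: "\<bar>\<phi> - (\<theta> - pi / 2)\<bar> \<le> pi"
  shows "left_tangent K w \<phi> \<theta>" "unwound w \<theta> = \<sigma>"
proof -
  have s: "sl \<theta> - \<sigma> \<ge> 0" using sl_after_start[OF start] by simp
  have eq: "w = xl (sl \<theta>) - (sl \<theta> - \<sigma>) *\<^sub>R tvec \<theta>" using w by (simp add: left_involute_def)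
  show "left_tangent K w \<phi> \<theta>" by (rule left_tangentI[OF sep contact_in_face eq s near])
  show "unwound w \<theta> = \<sigma>" using s by (simp add: unwound_def eq dist_norm)
qed

end


section \<open>Reflection\<close>

text \<open>The reflection \<open>\<theta> \<mapsto> - \<theta>\<close> turns a right system of \<open>K\<close> into a left system of the reflected body.\<close>

definition mirror :: "real^2 \<Rightarrow> real^2" where
  "mirror v = vector [v$1, - v$2]"

lemma mirror_nth [simp]: "mirror v $ 1 = v $ 1" "mirror v $ 2 = - v $ 2"
  by (simp_all add: mirror_def)

lemma mirror_mirror [simp]: "mirror (mirror v) = v"
  by (rule vec2_eqI) simp_all

lemma linear_mirror: "linear mirror"
  by (rule linearI) (rule vec2_eqI; simp)+

lemmas mirror_linear = linear_add[OF linear_mirror] linear_diff[OF linear_mirror]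
  linear_scale[OF linear_mirror]

lemma bij_mirror: "bij mirror"
  by (rule o_bij[of mirror]) (auto simp: o_def)

lemma inj_mirror: "inj mirror"
  by (rule bij_is_inj[OF bij_mirror])

lemma mirror_image_iff [simp]: "mirror x \<in> mirror ` S \<longleftrightarrow> x \<in> S"
  by (rule inj_image_mem_iff[OF inj_mirror])

lemma inner_mirror [simp]: "mirror u \<bullet> mirror v = u \<bullet> v"
  by (simp add: inner_real2)

lemma norm_mirror [simp]: "norm (mirror v) = norm v"
  by (simp add: norm_eq_sqrt_inner)

lemma dist_mirror [simp]: "dist (mirror u) (mirror v) = dist u v"
  by (simp add: dist_norm mirror_linear[symmetric])

lemma nvec_mirror: "nvec (- \<theta>) = mirror (nvec \<theta>)"
  by (rule vec2_eqI) simp_all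

lemma tvec_mirror: "tvec (- \<theta>) = - mirror (tvec \<theta>)"
  by (rule vec2_eqI) simp_all

lemma convex_body_mirror: "convex_body K \<Longrightarrow> convex_body (mirror ` K)"
  unfolding convex_body_def
  by (auto intro: convex_linear_image[OF linear_mirror]
      compact_continuous_image[OF linear_continuous_on[OF linear_mirror[unfolded linear_conv_bounded_linear]]])

lemma support_fun_mirror: "support_fun (mirror ` K) (- \<theta>) = support_fun K \<theta>"
  by (simp add: support_fun_def nvec_mirror image_image)

lemma face_mirror: "face (mirror ` K) (- \<theta>) = mirror ` face K \<theta>"
  by (auto simp: face_def support_fun_mirror nvec_mirror)

lemma separates_mirror: "separates (mirror ` K) (mirror x) (- \<phi>) \<longleftrightarrow> separates K x \<phi>"
  by (simp add: separates_def nvec_mirror)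

lemma interior_mirror: "interior (mirror ` S) = mirror ` interior S"
  by (rule interior_bijective_linear_image[OF linear_mirror bij_mirror])

lemma closure_mirror: "closure (mirror ` S) = mirror ` closure S"
  by (rule closure_injective_linear_image[OF linear_mirror inj_mirror, symmetric])

lemma frontier_mirror: "frontier (mirror ` S) = mirror ` frontier S"
  unfolding frontier_def interior_mirror closure_mirror by (rule image_set_diff[OF inj_mirror, symmetric])

lemma bij_betw_mirror: "bij_betw x A B \<Longrightarrow> bij_betw (mirror \<circ> x) A (mirror ` B)"
  by (rule bij_betw_trans) (auto simp: bij_betw_def intro: inj_on_subset[OF inj_mirror])

lemma boundary_param_mirror:
  assumes "boundary_param K L x" shows "boundary_param (mirror ` K) L (mirror \<circ> x)"
proof -
  have "curve_length (mirror \<circ> x) a b = curve_length x a b" for a b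
    by (simp add: curve_length_def)
  then show ?thesis using assms unfolding boundary_param_def interior_mirror frontier_mirror
    by (auto intro: bij_betw_mirror split: if_splits)
qed

lemma counterclockwise_mirror: "clockwise L x \<Longrightarrow> counterclockwise L (mirror \<circ> x)"
  unfolding clockwise_def counterclockwise_def det2_def by (simp add: algebra_simps)

lemma Lim_at_left_minus: "Lim (at_left \<theta>) (\<lambda>\<psi>. s (- \<psi>)) = Lim (at_right (- \<theta>)) (s :: real \<Rightarrow> real)"
  unfolding Topological_Spaces.Lim_def by (simp add: filterlim_at_left_to_right)

lemma left_system_mirror:
  assumes "right_system K L xr sr x0 s0 \<theta>0"
  shows "left_system (mirror ` K) L (mirror \<circ> xr) (\<lambda>\<theta>. sr (- \<theta>)) (mirror x0) s0 (- \<theta>0)"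
proof -
  note r = assms[unfolded right_system_def]
  have per: "sr (- (\<theta> + 2 * pi)) = sr (- \<theta>) + L" for \<theta>
  proof -
    have "sr (- (\<theta> + 2 * pi) + 2 * pi) = sr (- (\<theta> + 2 * pi)) - L" using r by blast
    then show ?thesis by simp
  qed
  have cont: "continuous (at_right \<theta>) (\<lambda>\<theta>. sr (- \<theta>))" for \<theta>
    using r filterlim_at_left_to_right[of sr "nhds (sr (- \<theta>))" "- \<theta>"]
    by (auto simp: continuous_within)
  have faces: "bij_betw (mirror \<circ> xr) {Lim (at_left \<theta>) (\<lambda>\<theta>. sr (- \<theta>))..sr (- \<theta>)} (face (mirror ` K) \<theta>)" for \<theta>
    using r face_mirror[of K "- \<theta>"] unfolding Lim_at_left_minus by (auto intro: bij_betw_mirror)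
  show ?thesis
    unfolding left_system_def using r per cont faces
    by (auto simp: boundary_param_mirror counterclockwise_mirror face_mirror Lim_at_left_minus
        intro!: monoI elim!: antimonoD)
qed

lemma left_start_mirror: "left_start (\<lambda>\<theta>. sr (- \<theta>)) \<sigma> = - right_start sr \<sigma>"
proof -
  have "x \<in> uminus ` {\<theta>. \<sigma> < sr (- \<theta>)} \<longleftrightarrow> x \<in> {\<theta>. \<sigma> < sr \<theta>}" for x
    by (auto simp: image_iff intro!: exI[of _ "- x"])
  then have "uminus ` {\<theta>. \<sigma> < sr (- \<theta>)} = {\<theta>. \<sigma> < sr \<theta>}" by blast
  then show ?thesis unfolding left_start_def right_start_def Inf_real_def by simp
qed

lemma left_involute_mirror:
  "left_involute (mirror \<circ> xr) (\<lambda>\<theta>. sr (- \<theta>)) \<sigma> (- \<theta>) = mirror (right_involute xr sr \<sigma> \<theta>)"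
  by (simp add: left_involute_def right_involute_def tvec_mirror mirror_linear)

lemma left_fence_mirror:
  "left_fence (mirror ` K) (mirror \<circ> xr) (\<lambda>\<theta>. sr (- \<theta>)) \<sigma> (- \<theta>r) = mirror ` right_fence K xr sr \<sigma> \<theta>r"
proof -
  have 1: "(mirror \<circ> xr) (sr (- \<theta>)) = mirror (xr (sr (- \<theta>)))"
    "left_involute (mirror \<circ> xr) (\<lambda>\<theta>. sr (- \<theta>)) \<sigma> \<theta> = mirror (right_involute xr sr \<sigma> (- \<theta>))" for \<theta>
    using left_involute_mirror[of xr sr \<sigma> "- \<theta>"] by auto
  let ?p = "\<lambda>t \<theta>. t *\<^sub>R xr (sr \<theta>) + (1 - t) *\<^sub>R right_involute xr sr \<sigma> \<theta>"
  have "{t *\<^sub>R (mirror \<circ> xr) (sr (- \<theta>)) + (1 - t) *\<^sub>R left_involute (mirror \<circ> xr) (\<lambda>\<theta>. sr (- \<theta>)) \<sigma> \<theta> | t \<theta>.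
      0 < t \<and> t < 1 \<and> - right_start sr \<sigma> < \<theta> \<and> \<theta> < - \<theta>r}
    = {mirror (?p t (- \<theta>)) | t \<theta>. 0 < t \<and> t < 1 \<and> - right_start sr \<sigma> < \<theta> \<and> \<theta> < - \<theta>r}"
    unfolding 1 mirror_linear ..
  also have "\<dots> = mirror ` {?p t \<theta> | t \<theta>. 0 < t \<and> t < 1 \<and> \<theta>r < \<theta> \<and> \<theta> < right_start sr \<sigma>}"
    (is "?A = mirror ` ?B")
  proof
    show "?A \<subseteq> mirror ` ?B" by force
    show "mirror ` ?B \<subseteq> ?A"
    proof
      fix v assume "v \<in> mirror ` ?B"
      then obtain t \<theta> where "v = mirror (?p t (- (- \<theta>)))" "0 < t" "t < 1" "\<theta>r < \<theta>" "\<theta> < right_start sr \<sigma>"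
        by auto
      then show "v \<in> ?A" by (intro CollectI exI[of _ t] exI[of _ "- \<theta>"]) auto
    qed
  qed
  finally show ?thesis
    unfolding left_fence_def right_fence_def left_start_mirror image_set_diff[OF inj_mirror] by simp
qed

lemma recedes_mirror:
  assumes "recedes K \<gamma> r"
  shows "recedes (mirror ` K) (mirror ` \<gamma>) (map_prod mirror mirror ` r)"
proof -
  define r' where "r' = map_prod mirror mirror ` r"
  have in_r: "(mirror a, mirror b) \<in> r' \<longleftrightarrow> (a, b) \<in> r" for a b
    unfolding r'_def by (force simp: image_iff dest: injD[OF inj_mirror])
  have "trans r'"
  proof (rule transI)
    fix a b c assume "(a, b) \<in> r'" "(b, c) \<in> r'"
    then have "(mirror a, mirror b) \<in> r" "(mirror b, mirror c) \<in> r"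
      using in_r[of "mirror a" "mirror b"] in_r[of "mirror b" "mirror c"] by auto
    moreover have "trans r" using assms by (simp add: recedes_def)
    ultimately have "(mirror a, mirror c) \<in> r" by (metis transD)
    then show "(a, c) \<in> r'" using in_r[of "mirror a" "mirror c"] by simp
  qed
  moreover have "connected {z\<in>mirror ` \<gamma>. (mirror a, z) \<in> r' \<and> (z, mirror b) \<in> r'}"
    if "a \<in> \<gamma>" "b \<in> \<gamma>" "(a, b) \<in> r" for a b
  proof -
    have "{z\<in>mirror ` \<gamma>. (mirror a, z) \<in> r' \<and> (z, mirror b) \<in> r'}
      = mirror ` {z\<in>\<gamma>. (a, z) \<in> r \<and> (z, b) \<in> r}" using in_r by auto
    then show ?thesis
      using recedesD(1)[OF assms that] connected_linear_image[OF linear_mirror] by simp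
  qed
  ultimately show ?thesis using assms unfolding r'_def[symmetric] by (auto simp: recedes_def in_r)
qed


section \<open>Order intervals of self-distancing curves\<close>

text \<open>In a separation of \<open>A\<close>, the set \<open>B\<close> can be added to the part that contains \<open>p\<close>, which separates
  \<open>A \<union> B\<close>.\<close>

lemma connected_part_at_cut_point:
  assumes "connected (A \<union> B)" "closed A" "closed B" "A \<inter> B = {p}"
  shows "connected A"
proof (rule ccontr)
  assume "\<not> connected A"
  then obtain E F where EF: "closed E" "closed F" "A \<subseteq> E \<union> F" "E \<inter> F \<inter> A = {}" "E \<inter> A \<noteq> {}" "F \<inter> A \<noteq> {}"
    unfolding connected_closed by blast
  have no: False if "p \<in> E" "closed E" "closed F" "A \<subseteq> E \<union> F" "E \<inter> F \<inter> A = {}" "F \<inter> A \<noteq> {}" for E F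
  proof -
    have "closed ((E \<inter> A) \<union> B)" "closed (F \<inter> A)" using that assms by auto
    moreover have "A \<union> B \<subseteq> ((E \<inter> A) \<union> B) \<union> (F \<inter> A)" using that by auto
    moreover have "((E \<inter> A) \<union> B) \<inter> (F \<inter> A) \<inter> (A \<union> B) = {}" using that assms(4) by auto
    moreover have "((E \<inter> A) \<union> B) \<inter> (A \<union> B) \<noteq> {}" "F \<inter> A \<inter> (A \<union> B) \<noteq> {}" using that assms(4) by auto
    ultimately show False using assms(1) unfolding connected_closed by blast
  qed
  have "p \<in> A" using assms(4) by auto
  then consider "p \<in> E" | "p \<in> F" using EF by auto
  then show False using no[of E F] no[of F E] EF by cases (auto simp: Int_ac Un_ac)
qed

lemma self_distancing_order:
  assumes "self_distancing \<gamma> r"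
  shows "trans r" "antisym r" "\<And>x. x \<in> \<gamma> \<Longrightarrow> (x, x) \<in> r"
    "\<And>x y. x \<in> \<gamma> \<Longrightarrow> y \<in> \<gamma> \<Longrightarrow> (x, y) \<in> r \<or> (y, x) \<in> r"
    "\<And>x y z. x \<in> \<gamma> \<Longrightarrow> y \<in> \<gamma> \<Longrightarrow> z \<in> \<gamma> \<Longrightarrow> (x, y) \<in> r \<Longrightarrow> (y, z) \<in> r \<Longrightarrow> dist x y \<le> dist x z"
proof -
  have lin: "linear_order_on \<gamma> r" using assms by (simp add: self_distancing_def)
  then show "trans r" "antisym r" and re: "\<And>x. x \<in> \<gamma> \<Longrightarrow> (x, x) \<in> r"
    by (auto simp: linear_order_on_def partial_order_on_def preorder_on_def refl_on_def)
  show "(x, y) \<in> r \<or> (y, x) \<in> r" if "x \<in> \<gamma>" "y \<in> \<gamma>" for x y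
    using lin re[OF that(1)] that by (cases "x = y") (auto simp: linear_order_on_def total_on_def)
  show "dist x y \<le> dist x z" if "x \<in> \<gamma>" "y \<in> \<gamma>" "z \<in> \<gamma>" "(x, y) \<in> r" "(y, z) \<in> r" for x y z
  proof -
    have "norm (y - x) \<le> norm (z - x)" using assms that unfolding self_distancing_def by blast
    then show ?thesis by (simp add: dist_norm norm_minus_commute)
  qed
qed

text \<open>If \<open>w\<close> lies between the limit \<open>y\<close> of a sequence and its members, then self-distancing bounds the
  distance of \<open>w\<close> from one of these ends by the distance of the ends, which tends to \<open>0\<close>; so
  \<open>w = y\<close>.\<close>

lemma self_distancing_rays_closed:
  assumes sd: "self_distancing \<gamma> r" and cl: "closed \<gamma>" and w: "w \<in> \<gamma>"
  shows "closed {z\<in>\<gamma>. (z, w) \<in> r}" "closed {z\<in>\<gamma>. (w, z) \<in> r}"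
proof -
  note o = self_distancing_order[OF sd]
  have "y \<in> \<gamma> \<and> (y, w) \<in> r" if f: "\<And>n. f n \<in> \<gamma> \<and> (f n, w) \<in> r" and lim: "f \<longlonglongrightarrow> y" for f y
  proof -
    have y: "y \<in> \<gamma>" using closed_sequentially[OF cl _ lim] f by blast
    have "(y, w) \<in> r" if "(w, y) \<in> r"
    proof -
      have "(\<lambda>n. dist (f n) y) \<longlonglongrightarrow> 0" using lim tendsto_dist_iff by blast
      moreover have "\<forall>n. norm (dist (f n) w) \<le> dist (f n) y" using o(5)[OF _ w y _ that] f by auto
      ultimately have "(\<lambda>n. dist (f n) w) \<longlonglongrightarrow> 0"
        by (intro Lim_null_comparison[of "\<lambda>n. dist (f n) w"]) auto
      then have "f \<longlonglongrightarrow> w" using tendsto_dist_iff by blast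
      then show ?thesis using LIMSEQ_unique[OF lim] o(3)[OF w] by auto
    qed
    then show ?thesis using y o(4)[OF y w] by blast
  qed
  then show "closed {z\<in>\<gamma>. (z, w) \<in> r}" unfolding closed_sequential_limits mem_Collect_eq by blast
  have "y \<in> \<gamma> \<and> (w, y) \<in> r" if f: "\<And>n. f n \<in> \<gamma> \<and> (w, f n) \<in> r" and lim: "f \<longlonglongrightarrow> y" for f y
  proof -
    have y: "y \<in> \<gamma>" using closed_sequentially[OF cl _ lim] f by blast
    have "(w, y) \<in> r" if "(y, w) \<in> r"
    proof -
      have "(\<lambda>n. dist y (f n)) \<longlonglongrightarrow> 0" using lim tendsto_dist_iff[of f y] by (simp add: dist_commute)
      moreover have "\<forall>n. dist y w \<le> dist y (f n)" using o(5)[OF y w _ that] f by auto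
      ultimately have "dist y w \<le> 0" by (intro LIMSEQ_le_const) auto
      then show ?thesis using o(3)[OF w] by simp
    qed
    then show ?thesis using y o(4)[OF y w] by blast
  qed
  then show "closed {z\<in>\<gamma>. (w, z) \<in> r}" unfolding closed_sequential_limits mem_Collect_eq by blast
qed

lemma self_distancing_intervals_connected:
  assumes sd: "self_distancing \<gamma> r" and cl: "closed \<gamma>" and con: "connected \<gamma>"
    and x: "x \<in> \<gamma>" "w \<in> \<gamma>" "(x, w) \<in> r"
  shows "connected {z\<in>\<gamma>. (x, z) \<in> r \<and> (z, w) \<in> r}"
proof -
  note o = self_distancing_order[OF sd]
  note c = self_distancing_rays_closed[OF sd cl]
  have below: "connected {z\<in>\<gamma>. (z, w) \<in> r}"
  proof (rule connected_part_at_cut_point[OF _ c(1)[OF x(2)] c(2)[OF x(2)]])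
    have "{z\<in>\<gamma>. (z, w) \<in> r} \<union> {z\<in>\<gamma>. (w, z) \<in> r} = \<gamma>" using o(4) x by blast
    then show "connected ({z\<in>\<gamma>. (z, w) \<in> r} \<union> {z\<in>\<gamma>. (w, z) \<in> r})" using con by simp
    show "{z\<in>\<gamma>. (z, w) \<in> r} \<inter> {z\<in>\<gamma>. (w, z) \<in> r} = {w}"
      using o(3) x antisymD[OF o(2)] by blast
  qed
  show ?thesis
  proof (rule connected_part_at_cut_point)
    have "{z\<in>\<gamma>. (x, z) \<in> r \<and> (z, w) \<in> r} \<union> {z\<in>\<gamma>. (z, x) \<in> r} = {z\<in>\<gamma>. (z, w) \<in> r}"
      using o(4) x transD[OF o(1)] by blast
    then show "connected ({z\<in>\<gamma>. (x, z) \<in> r \<and> (z, w) \<in> r} \<union> {z\<in>\<gamma>. (z, x) \<in> r})" using below by simp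
    show "{z\<in>\<gamma>. (x, z) \<in> r \<and> (z, w) \<in> r} \<inter> {z\<in>\<gamma>. (z, x) \<in> r} = {x}"
      using o(3) x antisymD[OF o(2)] by blast
    have "{z\<in>\<gamma>. (x, z) \<in> r \<and> (z, w) \<in> r} = {z\<in>\<gamma>. (x, z) \<in> r} \<inter> {z\<in>\<gamma>. (z, w) \<in> r}" by blast
    then show "closed {z\<in>\<gamma>. (x, z) \<in> r \<and> (z, w) \<in> r}" using c x by auto
    show "closed {z\<in>\<gamma>. (z, x) \<in> r}" by (rule c(1)[OF x(1)])
  qed
qed

lemma SDC_from_recedes:
  assumes "SDC_from K \<gamma> r" shows "recedes K \<gamma> r"
proof -
  have sd: "self_distancing \<gamma> r" "closed \<gamma>" "connected \<gamma>"
    and far: "\<forall>y\<in>K. \<forall>x\<in>\<gamma>. \<forall>x1\<in>\<gamma>. (x, x1) \<in> r \<longrightarrow> norm (x - y) \<le> norm (x1 - y)"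
    using assms by (simp_all add: SDC_from_def SDC_def)
  show ?thesis
    unfolding recedes_def dist_norm
    using self_distancing_order(1,3)[OF sd(1)] self_distancing_intervals_connected[OF sd] far by blast
qed

text \<open>Small pieces of the curve are separated from the body by a single direction, because
  self-distancing confines the points between \<open>a\<close> and \<open>b\<close> to the ball around \<open>a\<close> through \<open>b\<close>. Since
  order intervals are connected, steps along small pieces reach every earlier point.\<close>

lemma backward_induct:
  assumes K: "convex_body K" and sdc: "SDC_from K \<gamma> r"
    and x: "x \<in> \<gamma>" "w \<in> \<gamma>" "(x, w) \<in> r" "x \<notin> K" and w: "P w"
    and step: "\<And>\<phi> a b. a \<in> \<gamma> \<Longrightarrow> b \<in> \<gamma> \<Longrightarrow> (a, b) \<in> r \<Longrightarrow>
      (\<And>z. z \<in> \<gamma> \<Longrightarrow> (a, z) \<in> r \<Longrightarrow> (z, b) \<in> r \<Longrightarrow> separates K z \<phi>) \<Longrightarrow> P b \<Longrightarrow> P a"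
  shows "P x"
proof -
  have sd: "self_distancing \<gamma> r" using sdc by (simp add: SDC_from_def SDC_def)
  note o = self_distancing_order[OF sd]
  note rec = SDC_from_recedes[OF sdc]
  let ?S = "{z\<in>\<gamma>. (x, z) \<in> r \<and> (z, w) \<in> r}"
  let ?Q = "\<lambda>z. \<forall>z'\<in>\<gamma>. (z, z') \<in> r \<and> (z', w) \<in> r \<longrightarrow> P z'"
  have "?Q x"
  proof (rule connected_induction_simple[OF recedesD(1)[OF rec x(1-3)], of w x ?Q])
    show "w \<in> ?S" "x \<in> ?S" using x o(3) by auto
    show "?Q w" using w antisymD[OF o(2)] by blast
    fix a assume a: "a \<in> ?S"
    have "a \<notin> K"
    proof
      assume "a \<in> K"
      then have "dist x a \<le> dist a a" using recedesD(2)[OF rec x(1), of a a] a by auto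
      then show False using \<open>a \<in> K\<close> x(4) by simp
    qed
    then obtain \<phi> e where e: "e > 0" "\<And>z. dist a z < e \<Longrightarrow> separates K z \<phi>"
      using separates_nearby[OF K] by blast
    show "\<exists>T. openin (top_of_set ?S) T \<and> a \<in> T \<and> (\<forall>u\<in>T. \<forall>v\<in>T. ?Q u \<longrightarrow> ?Q v)"
    proof (intro exI[of _ "?S \<inter> ball a (e / 3)"] conjI ballI impI)
      show "openin (top_of_set ?S) (?S \<inter> ball a (e / 3))" by (rule openin_open_Int[OF open_ball])
      show "a \<in> ?S \<inter> ball a (e / 3)" using a e by simp
      fix u v z' assume uv: "u \<in> ?S \<inter> ball a (e / 3)" "v \<in> ?S \<inter> ball a (e / 3)" "?Q u"
        and z': "z' \<in> \<gamma>" "(v, z') \<in> r \<and> (z', w) \<in> r"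
      show "P z'"
      proof (cases "(u, z') \<in> r")
        case True then show ?thesis using uv z' by blast
      next
        case False
        then have le: "(z', u) \<in> r" using o(4) uv z' by blast
        have "P u" using uv o(3) by blast
        show ?thesis
        proof (rule step[OF z'(1) _ le _ \<open>P u\<close>, of \<phi>])
          show "u \<in> \<gamma>" using uv by simp
          fix z assume z: "z \<in> \<gamma>" "(z', z) \<in> r" "(z, u) \<in> r"
          then have "(v, z) \<in> r" using z' transD[OF o(1)] by blast
          then have "dist v z \<le> dist v u" using o(5)[of v z u] z uv by auto
          moreover have "dist v u \<le> dist a v + dist a u" by (metis dist_commute dist_triangle)
          moreover have "dist a z \<le> dist a v + dist v z" by (rule dist_triangle)
          ultimately show "separates K z \<phi>" using uv by (intro e(2)) auto
        qed
      qed
    qed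
  qed
  then show ?thesis using x o(3) by blast
qed


section \<open>The left and the right tangent of a point\<close>

lemma left_tangent_2pi_int:
  "left_tangent K x (\<phi> + 2 * pi * of_int k) (\<theta> + 2 * pi * of_int k) \<longleftrightarrow> left_tangent K x \<phi> \<theta>"
  by (simp only: left_tangent_def nvec_add_2pi_int support_fun_add_2pi_int) auto

lemma separates_between_tangents:
  assumes K: "convex_body K" and sep: "separates K x \<phi>"
    and l: "left_tangent K x \<phi> b" and r: "left_tangent (mirror ` K) (mirror x) (- \<phi>) (- a)"
    and psi: "a < \<psi>" "\<psi> < b"
  shows "separates K x \<psi>"
proof (cases "\<phi> \<le> \<psi>")
  case True
  then show ?thesis using separates_before_left_tangent[OF K sep l] psi by blast
next
  case False
  have "separates (mirror ` K) (mirror x) (- \<psi>)"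
    using separates_before_left_tangent[OF convex_body_mirror[OF K] _ r, of "- \<psi>"] sep False psi
    by (simp add: separates_mirror)
  then show ?thesis by (simp add: separates_mirror)
qed

text \<open>Such a point \<open>x\<close> would lie in the open wedge behind \<open>w\<close> between the prolonged tangents, so that
  \<open>x - w\<close> points away from \<open>K\<close>. But if no point of \<open>K\<close> is farther from \<open>x\<close> than from \<open>w\<close>, then
  \<open>x - w\<close> has a positive inner product with \<open>y - w\<close> for every \<open>y \<in> K\<close>. The contradiction comes from
  the points of contact of the two tangents through \<open>w\<close>.\<close>

lemma no_strictly_wider_tangents:
  assumes K: "convex_body K" and near: "\<And>y. y \<in> K \<Longrightarrow> dist x y \<le> dist w y" and neq: "x \<noteq> w"
    and w: "separates K w \<phi>" "left_tangent K w \<phi> b" "left_tangent (mirror ` K) (mirror w) (- \<phi>) (- a)"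
    and x: "separates K x \<psi>" "left_tangent K x \<psi> b'" "left_tangent (mirror ` K) (mirror x) (- \<psi>) (- a')"
    and wider: "a' < a" "b < b'"
  shows False
proof -
  define v where "v = x - w"
  have ab: "a < \<phi>" "\<phi> < b" using w by (auto simp: left_tangent_def)
  have width: "b - a \<le> pi"
  proof (rule ccontr)
    assume "\<not> b - a \<le> pi"
    moreover define h where "h = (a + b - pi) / 2"
    ultimately have "a < h" "h + pi < b" by auto
    moreover from this have "h < b" "a < h + pi" using pi_ge_two by linarith+
    ultimately have "separates K w h" "separates K w (h + pi)"
      using separates_between_tangents[OF K w] by blast+
    then show False using separates_not_opposite[OF K] by blast
  qed
  have toward: "v \<bullet> (y - w) > 0" if "y \<in> K" for y
  proof -
    have "(dist x y)\<^sup>2 \<le> (dist w y)\<^sup>2" using near[OF that] by (intro power_mono) auto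
    moreover have "x - y = v - (y - w)" "w - y = - (y - w)" by (simp_all add: v_def)
    ultimately have "(v - (y - w)) \<bullet> (v - (y - w)) \<le> (y - w) \<bullet> (y - w)"
      unfolding dist_norm by (simp only: power2_norm_eq_inner inner_minus_left inner_minus_right minus_minus)
    then have "v \<bullet> v \<le> 2 * (v \<bullet> (y - w))"
      unfolding inner_diff_left[of v] inner_diff_right[of _ v] inner_commute[of "y - w" v] by linarith
    moreover have "v \<bullet> v > 0" using neq by (simp add: v_def)
    ultimately show ?thesis by linarith
  qed
  have "separates K x a" "separates K x b"
    using ab wider by (auto intro: separates_between_tangents[OF K x])
  moreover have wb: "nvec b \<bullet> w = support_fun K b" using w by (simp add: left_tangent_def)
  moreover have wa: "nvec a \<bullet> w = support_fun K a"
    using w support_fun_mirror[of K a] by (simp add: left_tangent_def nvec_mirror)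
  ultimately have n: "nvec a \<bullet> v > 0" "nvec b \<bullet> v > 0"
    using K by (auto simp: separates_iff_support_fun v_def inner_diff_right)
  have ahead: "y - w = d" if "w = y - d" for y d using that by simp
  obtain y where y: "y \<in> face K b" using support_fun_attained[OF K] .
  have "w = y - dist w y *\<^sub>R tvec b" by (rule left_tangent_contact(3)[OF w(1,2) y])
  then have "y - w = dist w y *\<^sub>R tvec b" by (rule ahead)
  then have "dist w y * (tvec b \<bullet> v) > 0" using toward[OF faceD(1)[OF y]] by (simp add: inner_commute)
  then have tb: "tvec b \<bullet> v > 0" by (simp add: zero_less_mult_iff)
  obtain z where z: "z \<in> face K a" using support_fun_attained[OF K] .
  have "mirror z \<in> face (mirror ` K) (- a)" using z by (simp add: face_mirror)
  then have "mirror w = mirror z - dist (mirror w) (mirror z) *\<^sub>R tvec (- a)"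
    using w by (intro left_tangent_contact(3)[OF _ w(3)]) (auto simp: separates_mirror)
  then have "mirror w = mirror (z + dist w z *\<^sub>R tvec a)" by (simp add: tvec_mirror mirror_linear)
  then have "w = z + dist w z *\<^sub>R tvec a" using injD[OF inj_mirror] by blast
  then have "w = z - (- (dist w z *\<^sub>R tvec a))" by (simp only: diff_minus_eq_add)
  then have "z - w = - (dist w z *\<^sub>R tvec a)" by (rule ahead)
  then have "dist w z * (tvec a \<bullet> v) < 0"
    using toward[OF faceD(1)[OF z]] by (simp add: inner_commute)
  then have ta: "tvec a \<bullet> v < 0" by (simp add: mult_less_0_iff)
  have s: "sin (b - a) \<ge> 0" using ab width by (intro sin_ge_zero) auto
  have "cos (b - a) * (nvec a \<bullet> v) + sin (b - a) * (tvec a \<bullet> v) > 0"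
    using n(2) frame_rotate[of b v a] by simp
  moreover have "sin (b - a) * (tvec a \<bullet> v) \<le> 0" using s ta by (simp add: mult_nonneg_nonpos)
  ultimately have "cos (b - a) * (nvec a \<bullet> v) > 0" by linarith
  then have c: "cos (b - a) > 0" using n by (simp add: zero_less_mult_iff)
  have "tvec b \<bullet> v = cos (b - a) * (tvec a \<bullet> v) - sin (b - a) * (nvec a \<bullet> v)"
    by (rule tvec_rotate)
  moreover have "cos (b - a) * (tvec a \<bullet> v) < 0" using c ta by (simp add: mult_pos_neg)
  moreover have "sin (b - a) * (nvec a \<bullet> v) \<ge> 0" using s n by simp
  ultimately show False using tb by linarith
qed


section \<open>The curve before \<open>w\<close> lies in the fence\<close>

text \<open>The property transported backward asks for tangent angles on both sides of one common
  separating direction \<open>\<phi>\<close>. This keeps the full turns of the left and the right angle in step while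
  the curve winds around the body, so that in the end the two angles can be compared with those
  of \<open>w\<close> simultaneously.\<close>

lemma curve_outside_in_fences:
  assumes K: "convex_body K" and sdc: "SDC_from K \<gamma> r"
    and w: "w \<in> \<gamma>" "w \<notin> K"
    and left: "left_system K L xl sl \<xi>l \<sigma>l \<theta>0l" "left_start sl \<sigma>l \<le> \<theta>l"
      "w = left_involute xl sl \<sigma>l \<theta>l"
    and right: "right_system K L' xr sr \<xi>r \<sigma>r \<theta>0r" "\<theta>r \<le> right_start sr \<sigma>r"
      "w = right_involute xr sr \<sigma>r \<theta>r"
    and x: "x \<in> \<gamma>" "(x, w) \<in> r" "x \<notin> K"
  shows "x \<in> closure (left_fence K xl sl \<sigma>l \<theta>l) \<union> closure (right_fence K xr sr \<sigma>r \<theta>r)"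
proof -
  interpret l: left_unwinding K L xl sl \<xi>l \<sigma>l \<theta>0l
    using K left(1) by unfold_locales
  interpret r: left_unwinding "mirror ` K" L' "mirror \<circ> xr" "\<lambda>\<theta>. sr (- \<theta>)" "mirror \<xi>r" \<sigma>r "- \<theta>0r"
    using convex_body_mirror[OF K] left_system_mirror[OF right(1)] by unfold_locales
  note rec = SDC_from_recedes[OF sdc]
  \<comment> \<open>The angles \<open>\<theta>l\<close> and \<open>\<theta>r\<close> are chosen independently up to full turns; \<open>c\<close> is the multiple of a
    full turn that has to be added to the reflected angles in order to compare them.\<close>
  obtain \<phi>0 where sep0: "separates K w \<phi>0" using separates_nearby[OF K w(2)] by (metis dist_self)
  obtain k where k: "\<bar>\<phi>0 + 2 * pi * of_int k - (\<theta>l - pi / 2)\<bar> \<le> pi" using angle_shift_near by blast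
  obtain m where m: "\<bar>- \<phi>0 + 2 * pi * of_int m - (- \<theta>r - pi / 2)\<bar> \<le> pi" using angle_shift_near by blast
  define \<phi>w c where "\<phi>w = \<phi>0 + 2 * pi * of_int k" and "c = 2 * pi * of_int (m + k)"
  have sepw: "separates K w \<phi>w" unfolding \<phi>w_def using sep0 by (simp only: separates_2pi_int)
  have sep_c: "separates (mirror ` K) (mirror z) (- \<phi> + c) \<longleftrightarrow> separates K z \<phi>" for z \<phi>
    unfolding c_def separates_2pi_int separates_mirror ..
  have lt_c: "left_tangent (mirror ` K) (mirror z) (- \<phi> + c) \<theta>
      \<longleftrightarrow> left_tangent (mirror ` K) (mirror z) (- \<phi>) (\<theta> - c)" for z \<phi> \<theta>
    using left_tangent_2pi_int[of "mirror ` K" "mirror z" "- \<phi>" "m + k" "\<theta> - c"] by (simp add: c_def)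
  have wl: "left_tangent K w \<phi>w \<theta>l" "l.unwound w \<theta>l = \<sigma>l"
    using l.left_involute_tangent[OF left(3,2) sepw] k by (auto simp: \<phi>w_def)
  have "- \<phi>w + c = - \<phi>0 + 2 * pi * of_int m" by (simp add: \<phi>w_def c_def algebra_simps)
  then have "\<bar>- \<phi>w + c - (- \<theta>r - pi / 2)\<bar> \<le> pi" using m by simp
  moreover have "mirror w = left_involute (mirror \<circ> xr) (\<lambda>\<theta>. sr (- \<theta>)) \<sigma>r (- \<theta>r)"
    unfolding right(3) left_involute_mirror ..
  moreover have "left_start (\<lambda>\<theta>. sr (- \<theta>)) \<sigma>r \<le> - \<theta>r" using right(2) by (simp add: left_start_mirror)
  ultimately have wr: "left_tangent (mirror ` K) (mirror w) (- \<phi>w + c) (- \<theta>r)"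
      "r.unwound (mirror w) (- \<theta>r) = \<sigma>r"
    using r.left_involute_tangent sepw sep_c by blast+
  show ?thesis
  proof (cases "x = w")
    case True
    then show ?thesis using l.left_reach_in_closure[OF sepw wl(1)] wl(2) by auto
  next
    case False
    let ?P = "\<lambda>z. \<exists>\<phi>. separates K z \<phi> \<and> l.left_reach \<sigma>l z \<phi> \<and> r.left_reach \<sigma>r (mirror z) (- \<phi> + c)"
    have "?P x"
    proof (rule backward_induct[OF K sdc x(1) w(1) x(2,3), of ?P])
      show "?P w" using sepw wl wr unfolding l.left_reach_def r.left_reach_def by fastforce
    next
      fix \<phi>' a b assume ab: "a \<in> \<gamma>" "b \<in> \<gamma>" "(a, b) \<in> r"
        and sep': "\<And>z. z \<in> \<gamma> \<Longrightarrow> (a, z) \<in> r \<Longrightarrow> (z, b) \<in> r \<Longrightarrow> separates K z \<phi>'" and "?P b"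
      then obtain \<phi>1 where b: "separates K b \<phi>1" "l.left_reach \<sigma>l b \<phi>1" "r.left_reach \<sigma>r (mirror b) (- \<phi>1 + c)"
        by blast
      \<comment> \<open>The direction \<open>\<phi>'\<close> that separates the whole piece is replaced by the angle closest to the
        direction \<open>\<phi>1\<close> known at \<open>b\<close>.\<close>
      obtain k where k: "\<bar>\<phi>' + 2 * pi * of_int k - \<phi>1\<bar> \<le> pi" using angle_shift_near by blast
      define \<phi> where "\<phi> = \<phi>' + 2 * pi * of_int k"
      have sep: "\<And>z. z \<in> \<gamma> \<Longrightarrow> (a, z) \<in> r \<Longrightarrow> (z, b) \<in> r \<Longrightarrow> separates K z \<phi>"
        using sep' unfolding \<phi>_def separates_2pi_int .
      have "(a, a) \<in> r" "(b, b) \<in> r" using ab rec by (auto simp: recedes_def)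
      then have ends: "separates K a \<phi>" "separates K b \<phi>" using ab sep by blast+
      have "\<phi> \<noteq> \<phi>1 + pi" "\<phi>1 \<noteq> \<phi> + pi"
        using ends(2) b(1) separates_not_opposite[OF K] by metis+
      then have "\<bar>\<phi> - \<phi>1\<bar> < pi" using k unfolding \<phi>_def by linarith
      then have "l.left_reach \<sigma>l b \<phi>" "r.left_reach \<sigma>r (mirror b) (- \<phi> + c)"
        using b ends sep_c l.left_reach_shift[of \<sigma>l b \<phi>1 \<phi>]
          r.left_reach_shift[of \<sigma>r "mirror b" "- \<phi>1 + c" "- \<phi> + c"] by auto
      moreover have "l.left_reach \<sigma>l b \<phi> \<Longrightarrow> l.left_reach \<sigma>l a \<phi>"
        by (rule l.left_reach_backward[OF rec ab sep])
      moreover have "r.left_reach \<sigma>r (mirror b) (- \<phi> + c) \<Longrightarrow> r.left_reach \<sigma>r (mirror a) (- \<phi> + c)"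
      proof (rule r.left_reach_backward[OF recedes_mirror[OF rec]])
        fix z assume "z \<in> mirror ` \<gamma>" "(mirror a, z) \<in> map_prod mirror mirror ` r"
          "(z, mirror b) \<in> map_prod mirror mirror ` r"
        then obtain z' where "z = mirror z'" "z' \<in> \<gamma>" "(a, z') \<in> r" "(z', b) \<in> r"
          by (auto dest!: injD[OF inj_mirror])
        then show "separates (mirror ` K) z (- \<phi> + c)" using sep sep_c by simp
      qed (use ab in \<open>auto intro: rev_image_eqI\<close>)
      ultimately show "?P a" using ends by blast
    qed
    then obtain \<phi> b a' where sepx: "separates K x \<phi>"
      and b: "left_tangent K x \<phi> b" "\<sigma>l \<le> l.unwound x b"
      and a': "left_tangent (mirror ` K) (mirror x) (- \<phi> + c) a'" "\<sigma>r \<le> r.unwound (mirror x) a'"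
      unfolding l.left_reach_def r.left_reach_def by blast
    consider "b \<le> \<theta>l" | "a' \<le> - \<theta>r" | "\<theta>l < b" "- \<theta>r < a'" by linarith
    then show ?thesis
    proof cases
      case 1
      then show ?thesis using l.left_reach_in_closure[OF sepx b] by blast
    next
      case 2
      then have "mirror x \<in> closure (left_fence (mirror ` K) (mirror \<circ> xr) (\<lambda>\<theta>. sr (- \<theta>)) \<sigma>r (- \<theta>r))"
        using sepx sep_c by (intro r.left_reach_in_closure[OF _ a']) auto
      then show ?thesis by (simp add: left_fence_mirror closure_mirror)
    next
      case 3
      show ?thesis
      proof (rule FalseE, rule no_strictly_wider_tangents[OF K _ False sepw wl(1) _ sepx b(1)])
        show "dist x y \<le> dist w y" if "y \<in> K" for y using recedesD(2)[OF rec x(1) w(1) x(2) that] .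
        show "left_tangent (mirror ` K) (mirror w) (- \<phi>w) (- (\<theta>r + c))" using wr(1) lt_c by simp
        show "left_tangent (mirror ` K) (mirror x) (- \<phi>) (- (c - a'))" using a'(1) lt_c by simp
        show "c - a' < \<theta>r + c" "\<theta>l < b" using 3 by auto
      qed
    qed
  qed
qed

theorem theorem4p5:
  fixes K \<gamma> G :: "(real^2) set" and r :: "(real^2) rel" and w :: "real^2"
  assumes "convex_body K" and "\<nexists>a. K = {a}"
    and "SDC_from K \<gamma> r"
    and "w \<in> \<gamma>" and "w \<notin> K"
    and "is_fence K w G"
  shows "{y \<in> \<gamma>. (y, w) \<in> r} \<subseteq> closure G"
proof
  fix y assume "y \<in> {y \<in> \<gamma>. (y, w) \<in> r}"
  then have y: "y \<in> \<gamma>" "(y, w) \<in> r" by auto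
  obtain L xl sl \<xi>l \<sigma>l \<theta>0l \<theta>l xr sr \<xi>r \<sigma>r \<theta>0r \<theta>r where
    left: "left_system K L xl sl \<xi>l \<sigma>l \<theta>0l" "left_start sl \<sigma>l \<le> \<theta>l" "w = left_involute xl sl \<sigma>l \<theta>l"
    and right: "right_system K L xr sr \<xi>r \<sigma>r \<theta>0r" "\<theta>r \<le> right_start sr \<sigma>r"
      "w = right_involute xr sr \<sigma>r \<theta>r"
    and G: "G = interior (closure (left_fence K xl sl \<sigma>l \<theta>l \<union> right_fence K xr sr \<sigma>r \<theta>r)) - K"
    using assms(6) unfolding is_fence_def by blast
  let ?F = "left_fence K xl sl \<sigma>l \<theta>l" and ?F' = "right_fence K xr sr \<sigma>r \<theta>r"
  interpret l: left_unwinding K L xl sl \<xi>l \<sigma>l \<theta>0l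
    using assms(1) left(1) by unfold_locales
  interpret r: left_unwinding "mirror ` K" L "mirror \<circ> xr" "\<lambda>\<theta>. sr (- \<theta>)" "mirror \<xi>r" \<sigma>r "- \<theta>0r"
    using convex_body_mirror[OF assms(1)] left_system_mirror[OF right(1)] by unfold_locales
  have "open ?F'"
    using open_bijective_linear_image_eq[OF linear_mirror bij_mirror] r.open_left_fence
    by (metis left_fence_mirror)
  then have "open (?F \<union> ?F')" using l.open_left_fence by blast
  then have "?F \<union> ?F' \<subseteq> interior (closure (?F \<union> ?F'))" by (intro interior_maximal closure_subset)
  moreover have "(?F \<union> ?F') \<inter> K = {}" by (auto simp: left_fence_def right_fence_def)
  ultimately have "?F \<union> ?F' \<subseteq> G" unfolding G by blast
  then have "closure ?F \<union> closure ?F' \<subseteq> closure G" by (metis closure_Un closure_mono)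
  then have out: "x \<in> closure G" if "x \<in> \<gamma>" "(x, w) \<in> r" "x \<notin> K" for x
    using curve_outside_in_fences[OF assms(1,3,4,5) left right that] by blast
  show "y \<in> closure G"
  proof (cases "y \<in> K")
    case False
    then show ?thesis using out y by blast
  next
    \<comment> \<open>A point of the body on the curve precedes all others, and it is the limit of the points of
      the curve following it.\<close>
    case True
    note rec = SDC_from_recedes[OF assms(3)]
    let ?S = "{z\<in>\<gamma>. (y, z) \<in> r \<and> (z, w) \<in> r}"
    have ends: "y \<in> ?S" "w \<in> ?S" using rec y assms(4) by (auto simp: recedes_def)
    have "y \<noteq> w" using True assms(5) by blast
    then have "?S \<noteq> {p}" for p using ends by (metis singletonD)
    then have "y islimpt ?S"
      by (rule connected_imp_perfect[OF recedesD(1)[OF rec y(1) assms(4) y(2)] ends(1)])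
    then have "y \<in> closure (?S - {y})" by (simp add: islimpt_in_closure)
    moreover have "?S - {y} \<subseteq> closure G"
    proof
      fix z assume z: "z \<in> ?S - {y}"
      have "z \<notin> K"
      proof
        assume "z \<in> K"
        then have "dist y z \<le> dist z z" using recedesD(2)[OF rec y(1), of z z] z by auto
        then show False using z by simp
      qed
      then show "z \<in> closure G" using z by (intro out) auto
    qed
    ultimately show ?thesis using closure_minimal[OF _ closed_closure] by blast
  qed
qed

end
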